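(* For every $A>30$ there is a constant $c=c(A)>0$, depending only on $A$, such that for every Jordan arc $\Gamma\subseteq \ell_2$ and every multiresolution family $\mathscr{H}$ for $\Gamma$ with inflation factor $A$, $$\sum_{Q\in\mathscr{H}}\beta_\Gamma(Q)^2\,\mathrm{diam}(Q)\ \ge\ c\,\bigl(\ell(\Gamma)-\mathrm{crd}(\Gamma)\bigr).$$
   Context: $\ell_2$ is the Hilbert space of square-summable real sequences. Jordan arc: a set $\Gamma\subseteq\ell_2$ with $\mathcal{H}^1(\Gamma)<\infty$ ($\mathcal{H}^1$ is one-dimensional Hausdorff measure) such that there is a continuous bijection $\gamma:[a,b]\to\Gamma$ from a closed interval $[a,b]\subseteq\mathbb{R}$. Its length is $\ell(\Gamma)=\sup\sum_i|\gamma(t_{i-1})-\gamma(t_i)|$ (supremum over finite increasing sequences in $[a,b]$), which equals $\mathcal{H}^1(\Gamma)$, and its chord length is $\mathrm{crd}(\Gamma)=|\gamma(a)-\gamma(b)|$. Jones beta number: for $E,Q\subseteq\ell_2$ with $Q$ of finite diameter, $\beta_E(Q)=\inf_L\sup_{x\in Q\cap E}\frac{\mathrm{dist}(x,L)}{\mathrm{diam}(Q)}$, where $L$ ranges over all affine lines in $\ell_2$. Multiresolution family: for $\epsilon>0$, an $\epsilon$-net of a connected set $\Sigma\subseteq\ell_2$ is a subset $E\subseteq\Sigma$ such that $|x-y|>\epsilon$ for all distinct $x,y\in E$ and $\Sigma\subseteq\bigcup_{x\in E}B(x,\epsilon)$, where $B(x,r)$ is the closed ball. Fix an integer $n_0$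 (an arbitrary starting index, which is of no consequence: the result is independent of it) and sets $X_n\subseteq\Sigma$ ($n\ge n_0$) such that $X_n$ is a $2^{-n}$-net of $\Sigma$ and $X_n\subseteq X_{n+1}$. For $A>1$, the family $\mathscr{H}=\{B(x,A2^{-n}):x\in X_n,\ n\in\mathbb{Z},\ n\ge n_0\}$ is called a multiresolution family for $\Sigma$ with inflation factor $A$.
   Formalization: The starting index is not arbitrary: the formal theorem assumes diam(Γ) ≤ 2^{-n_0}; for a fixed n_0 the inequality fails for two orthogonal segments of length R sharing an endpoint as R → ∞, since the sum stays bounded. *)

theory Defs
  imports "HOL-Analysis.Analysis"
begin

section \<open>The Hilbert space of square-summable real sequences\<close>

typedef ell2 = "{x :: nat \<Rightarrow> real. summable (\<lambda>i. (x i)\<^sup>2)}"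
  morphisms coord Abs_ell2
  by (rule exI[of _ "\<lambda>_. 0"]) simp

lemma summable_coord_square: "summable (\<lambda>i. (coord x i)\<^sup>2)"
  using coord[of x] by simp

lemma ell2_eqI: "(\<And>i. coord x i = coord y i) \<Longrightarrow> x = y"
  by (simp add: coord_inject[symmetric] ext)

lemma summable_mult_of_square_summable:
  fixes f g :: "nat \<Rightarrow> real"
  assumes "summable (\<lambda>i. (f i)\<^sup>2)" "summable (\<lambda>i. (g i)\<^sup>2)"
  shows "summable (\<lambda>i. f i * g i)"
proof (rule summable_comparison_test')
  show "summable (\<lambda>i. (f i)\<^sup>2 + (g i)\<^sup>2)"
    using assms by (rule summable_add)
  fix i :: nat
  have "2 * \<bar>f i * g i\<bar> \<le> (f i)\<^sup>2 + (g i)\<^sup>2"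
    using sum_squares_bound[of "\<bar>f i\<bar>" "\<bar>g i\<bar>"] by (simp add: abs_mult)
  then show "norm (f i * g i) \<le> (f i)\<^sup>2 + (g i)\<^sup>2"
    by simp
qed

lemma summable_coord_mult: "summable (\<lambda>i. coord x i * coord y i)"
  by (intro summable_mult_of_square_summable summable_coord_square)

lemma square_summable_add:
  fixes f g :: "nat \<Rightarrow> real"
  assumes "summable (\<lambda>i. (f i)\<^sup>2)" "summable (\<lambda>i. (g i)\<^sup>2)"
  shows "summable (\<lambda>i. (f i + g i)\<^sup>2)"
  unfolding power2_sum mult.assoc
  by (intro summable_add summable_mult summable_mult_of_square_summable assms)

instantiation ell2 :: real_inner
begin

definition "0 = Abs_ell2 (\<lambda>_. 0)"
definition "x + y = Abs_ell2 (\<lambda>i. coord x i + coord y i)"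
definition "- x = Abs_ell2 (\<lambda>i. - coord x i)"
definition "x - y = Abs_ell2 (\<lambda>i. coord x i - coord y i)"
definition "r *\<^sub>R x = Abs_ell2 (\<lambda>i. r * coord x i)"
definition "inner x y = (\<Sum>i. coord x i * coord y i)"
definition norm_ell2: "norm x = sqrt (\<Sum>i. (coord x i)\<^sup>2)"
definition dist_ell2: "dist x y = norm (x - y :: ell2)"
definition sgn_ell2: "sgn (x :: ell2) = inverse (norm x) *\<^sub>R x"
definition uniformity_ell2:
  "(uniformity :: (ell2 \<times> ell2) filter) = (INF e\<in>{0<..}. principal {(x, y). dist x y < e})"
definition open_ell2:
  "open (U :: ell2 set) \<longleftrightarrow> (\<forall>x\<in>U. eventually (\<lambda>(x', y). x' = x \<longrightarrow> y \<in> U) uniformity)"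

lemma coord_zero [simp]: "coord 0 i = 0"
  by (simp add: zero_ell2_def Abs_ell2_inverse)

lemma coord_add [simp]: "coord (x + y) i = coord x i + coord y i"
  by (simp add: plus_ell2_def Abs_ell2_inverse square_summable_add summable_coord_square)

lemma coord_uminus [simp]: "coord (- x) i = - coord x i"
  by (simp add: uminus_ell2_def Abs_ell2_inverse summable_coord_square)

lemma coord_minus [simp]: "coord (x - y) i = coord x i - coord y i"
  using square_summable_add[of "coord x" "\<lambda>i. - coord y i"]
  by (simp add: minus_ell2_def Abs_ell2_inverse summable_coord_square)

lemma coord_scaleR [simp]: "coord (r *\<^sub>R x) i = r * coord x i"
  by (simp add: scaleR_ell2_def Abs_ell2_inverse power_mult_distrib
      summable_mult summable_coord_square)

instance
proof
  fix x y z :: ell2 and r :: real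
  show "inner x y = inner y x"
    by (simp add: inner_ell2_def mult.commute)
  show "inner (x + y) z = inner x z + inner y z"
    by (simp add: inner_ell2_def distrib_right suminf_add summable_coord_mult)
  show "inner (r *\<^sub>R x) y = r * inner x y"
    by (simp add: inner_ell2_def mult.assoc suminf_mult summable_coord_mult)
  show "0 \<le> inner x x"
    by (simp add: inner_ell2_def suminf_nonneg summable_coord_mult)
  show "inner x x = 0 \<longleftrightarrow> x = 0"
    using suminf_eq_zero_iff[OF summable_coord_mult[of x x]]
    by (auto simp: inner_ell2_def intro!: ell2_eqI)
  show "norm x = sqrt (inner x x)"
    by (simp add: norm_ell2 inner_ell2_def power2_eq_square)
qed (auto intro!: ell2_eqI simp: algebra_simps dist_ell2 sgn_ell2 uniformity_ell2 open_ell2)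

end

lemma norm_ell2_square: "(norm x)\<^sup>2 = (\<Sum>i. (coord x i)\<^sup>2)"
  by (simp add: norm_ell2 suminf_nonneg summable_coord_square)

lemma sum_coord_square_le: "(\<Sum>i<n. (coord x i)\<^sup>2) \<le> (norm x)\<^sup>2"
  unfolding norm_ell2_square by (rule sum_le_suminf) (auto simp: summable_coord_square)

lemma abs_coord_le_norm: "\<bar>coord x i\<bar> \<le> norm x"
proof (rule power2_le_imp_le)
  have "(coord x i)\<^sup>2 \<le> (\<Sum>j<Suc i. (coord x j)\<^sup>2)"
    by (simp add: sum_nonneg)
  then show "\<bar>coord x i\<bar>\<^sup>2 \<le> (norm x)\<^sup>2"
    using sum_coord_square_le[where n = "Suc i" and x = x] by simp
qed simp

instance ell2 :: complete_space
proof
  fix X :: "nat \<Rightarrow> ell2"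
  assume X: "Cauchy X"
  have "Cauchy (\<lambda>n. coord (X n) i)" for i
  proof (rule CauchyI)
    fix e :: real
    assume "0 < e"
    then obtain M where "\<forall>m\<ge>M. \<forall>n\<ge>M. norm (X m - X n) < e"
      using CauchyD[OF X] by blast
    moreover have "norm (coord (X m) i - coord (X n) i) \<le> norm (X m - X n)" for m n
      using abs_coord_le_norm[of "X m - X n" i] by simp
    ultimately show "\<exists>M. \<forall>m\<ge>M. \<forall>n\<ge>M. norm (coord (X m) i - coord (X n) i) < e"
      by (blast intro: le_less_trans)
  qed
  then have "\<exists>l. \<forall>i. (\<lambda>n. coord (X n) i) \<longlonglongrightarrow> l i"
    by (intro choice allI) (simp add: Cauchy_convergent_iff convergent_def)
  then obtain l where l: "(\<lambda>n. coord (X n) i) \<longlonglongrightarrow> l i" for i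
    by blast
  have bound: "(\<Sum>i<k. (coord (X m) i - l i)\<^sup>2) \<le> e\<^sup>2"
    if M: "\<forall>m\<ge>M. \<forall>n\<ge>M. norm (X m - X n) < e" and "m \<ge> M" for e M m k
  proof (rule LIMSEQ_le_const2)
    show "(\<lambda>n. \<Sum>i<k. (coord (X m) i - coord (X n) i)\<^sup>2) \<longlonglongrightarrow> (\<Sum>i<k. (coord (X m) i - l i)\<^sup>2)"
      by (intro tendsto_intros l)
    have "(\<Sum>i<k. (coord (X m) i - coord (X n) i)\<^sup>2) \<le> e\<^sup>2" if "n \<ge> M" for n
    proof -
      have "(\<Sum>i<k. (coord (X m - X n) i)\<^sup>2) \<le> (norm (X m - X n))\<^sup>2"
        by (rule sum_coord_square_le)
      also have "\<dots> \<le> e\<^sup>2"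
        using M \<open>m \<ge> M\<close> that by (intro power_mono less_imp_le[of "norm _"]) simp_all
      finally show ?thesis by simp
    qed
    then show "\<exists>N. \<forall>n\<ge>N. (\<Sum>i<k. (coord (X m) i - coord (X n) i)\<^sup>2) \<le> e\<^sup>2"
      by blast
  qed
  have diff: "summable (\<lambda>i. (coord (X m) i - l i)\<^sup>2)"
    if "\<forall>m\<ge>M. \<forall>n\<ge>M. norm (X m - X n) < e" "m \<ge> M" for e M m
  proof (rule bounded_imp_summable)
    show "(\<Sum>i\<le>k. (coord (X m) i - l i)\<^sup>2) \<le> e\<^sup>2" for k
      using bound[OF that, of "Suc k"] by (simp only: lessThan_Suc_atMost)
  qed simp
  obtain M1 where M1: "\<forall>m\<ge>M1. \<forall>n\<ge>M1. norm (X m - X n) < 1"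
    using CauchyD[OF X, of 1] by auto
  have "summable (\<lambda>i. (l i - coord (X M1) i)\<^sup>2)"
    using diff[OF M1 order_refl] by (simp add: power2_commute)
  from square_summable_add[OF this summable_coord_square[of "X M1"]]
  have "summable (\<lambda>i. (l i)\<^sup>2)" by simp
  then have cl: "coord (Abs_ell2 l) = l"
    by (simp add: Abs_ell2_inverse)
  have "X \<longlonglongrightarrow> Abs_ell2 l"
  proof (rule LIMSEQ_I)
    fix r :: real
    assume "0 < r"
    then obtain M where M: "\<forall>m\<ge>M. \<forall>n\<ge>M. norm (X m - X n) < r / 2"
      using CauchyD[OF X, of "r / 2"] by auto
    have "norm (X n - Abs_ell2 l) < r" if "n \<ge> M" for n
    proof -
      have "(norm (X n - Abs_ell2 l))\<^sup>2 \<le> (r / 2)\<^sup>2"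
        unfolding norm_ell2_square coord_minus cl
        by (intro suminf_le_const diff[OF M that] bound[OF M that])
      then have "norm (X n - Abs_ell2 l) \<le> r / 2"
        by (rule power2_le_imp_le) (use \<open>0 < r\<close> in simp)
      then show ?thesis using \<open>0 < r\<close> by simp
    qed
    then show "\<exists>M. \<forall>n\<ge>M. norm (X n - Abs_ell2 l) < r" by blast
  qed
  then show "convergent X"
    by (rule convergentI)
qed

section \<open>One-dimensional Hausdorff measure\<close>

text \<open>\<^const>\<open>diameter\<close> is only meaningful on bounded sets, hence the boundedness
  requirement; the empty set has diameter 0, so finite covers are included.\<close>

definition hausdorff_content1 :: "real \<Rightarrow> 'a::metric_space set \<Rightarrow> ennreal" where
  "hausdorff_content1 \<delta> E =
     (INF C\<in>{C :: nat \<Rightarrow> 'a set. E \<subseteq> (\<Union>i. C i) \<and> (\<forall>i. bounded (C i) \<and> diameter (C i) \<le> \<delta>)}.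
        \<Sum>i. ennreal (diameter (C i)))"

definition hausdorff_measure1 :: "'a::metric_space set \<Rightarrow> ennreal" where
  "hausdorff_measure1 E = (SUP \<delta>\<in>{0<..}. hausdorff_content1 \<delta> E)"

section \<open>Jordan arcs\<close>

definition jordan_arc_param ::
    "'a::metric_space set \<Rightarrow> real \<Rightarrow> real \<Rightarrow> (real \<Rightarrow> 'a) \<Rightarrow> bool" where
  "jordan_arc_param \<Gamma> a b \<gamma> \<longleftrightarrow>
     hausdorff_measure1 \<Gamma> < \<infinity> \<and> a \<le> b \<and> continuous_on {a..b} \<gamma> \<and> bij_betw \<gamma> {a..b} \<Gamma>"

text \<open>Length and chord length do not depend on the choice of the parametrization.\<close>

definition arc_length :: "real \<Rightarrow> real \<Rightarrow> (real \<Rightarrow> 'a::metric_space) \<Rightarrow> ennreal" where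
  "arc_length a b \<gamma> =
     (SUP (n, t)\<in>{(n :: nat, t :: nat \<Rightarrow> real). strict_mono_on {..n} t \<and> t ` {..n} \<subseteq> {a..b}}.
        \<Sum>i=1..n. ennreal (dist (\<gamma> (t (i - 1))) (\<gamma> (t i))))"

definition chord_length :: "real \<Rightarrow> real \<Rightarrow> (real \<Rightarrow> 'a::metric_space) \<Rightarrow> real" where
  "chord_length a b \<gamma> = dist (\<gamma> a) (\<gamma> b)"

section \<open>Jones beta numbers\<close>

definition affine_lines :: "'a::real_vector set set" where
  "affine_lines = {range (\<lambda>t::real. p + t *\<^sub>R v) | p v. v \<noteq> 0}"

text \<open>Extended nonnegative values make the supremum over the empty set equal to 0.\<close>

definition jones_beta :: "'a::real_normed_vector set \<Rightarrow> 'a set \<Rightarrow> ennreal" where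
  "jones_beta E Q = (INF L\<in>affine_lines. SUP x\<in>Q \<inter> E. ennreal (infdist x L / diameter Q))"

section \<open>Multiresolution families\<close>

definition epsilon_net :: "real \<Rightarrow> 'a::metric_space set \<Rightarrow> 'a set \<Rightarrow> bool" where
  "epsilon_net \<epsilon> \<Sigma> E \<longleftrightarrow>
     E \<subseteq> \<Sigma> \<and> pairwise (\<lambda>x y. dist x y > \<epsilon>) E \<and> \<Sigma> \<subseteq> (\<Union>x\<in>E. cball x \<epsilon>)"

definition multiresolution_family ::
    "real \<Rightarrow> int \<Rightarrow> 'a::metric_space set \<Rightarrow> 'a set set \<Rightarrow> bool" where
  "multiresolution_family A n\<^sub>0 \<Sigma> \<H> \<longleftrightarrow>
     (\<exists>X :: int \<Rightarrow> 'a set.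
        (\<forall>n\<ge>n\<^sub>0. epsilon_net (2 powi (- n)) \<Sigma> (X n) \<and> X n \<subseteq> X (n + 1)) \<and>
        \<H> = {cball x (A * 2 powi (- n)) | x n. n \<ge> n\<^sub>0 \<and> x \<in> X n})"

text \<open>A lower bound for sums over \<open>\<H>\<close> in terms of the geometry of \<open>\<Sigma>\<close> needs a starting index
  that is coarse enough for \<open>\<Sigma>\<close>: if \<open>\<Sigma>\<close> consists of two orthogonal segments of length \<open>R\<close> with a
  common endpoint, the sum of \<open>\<beta>\<^sup>2 diam\<close> starting at a fixed \<open>n\<^sub>0\<close> stays bounded as \<open>R\<close> grows.
  The normalization used is \<open>diameter \<Sigma> \<le> 2 powi (- n\<^sub>0)\<close>.\<close>

end

theory Submission
  imports Defs
begin

text \<open>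
  The theorem says that the length of an arc exceeds its chord by at most a multiple of the beta
  sum. The proof bounds the Hausdorff measure of the set \<open>\<Gamma>\<close> and then returns to the arc.

  \<^item> \<^emph>\<open>Measure of a set.\<close> Let \<open>h \<delta>\<close> be the Hausdorff content of \<open>\<Gamma>\<close> with mesh \<open>\<delta>\<close>, an increasing
    quantity as \<open>\<delta>\<close> decreases to 0, whose limit is the Hausdorff measure. What does halving the mesh
    cost? Take a nearly optimal cover. A piece of diameter \<open>d\<close> comparable to the scale \<open>s\<close> that lies
    in a tube of radius \<open>\<theta> s\<close> around a line can be cut by hyperplanes orthogonal to the line; by
    Pythagoras the diameters of the parts add up to at most \<open>d + O(\<theta>\<^sup>2 s)\<close>. Since the cover is nearly
    optimal, only boundedly many large pieces lie near one net point: otherwise slicing the whole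
    tube there would be cheaper. Near a net point where \<open>\<Gamma>\<close> is not flat, \<open>\<theta>\<^sup>2 s\<close> is comparable to
    \<open>s\<close> and pays for a ball around the net point. Hence the loss at scale \<open>s\<close> is at most a constant
    times the sum of \<open>\<beta>\<^sup>2 diam\<close> over the balls of that scale (\<open>hausdorff_content1_halve\<close>,
    \<open>hausdorff_content1_halve_beta\<close>). At the coarsest scale the content is at most the diameter, so summing over all scales gives
    \<open>H\<^sup>1 \<Gamma> \<le> diam \<Gamma> + S\<close>, where \<open>S\<close> is a multiple of the beta sum
    (\<open>hausdorff_measure1_le_diameter_plus_beta\<close>). The covers see only the set \<open>\<Gamma>\<close> and not its
    parametrization, so strands of an arc that return close to each other cause no difficulty.

  \<^item> \<^emph>\<open>From diameter to chord.\<close> Let \<open>p\<close> and \<open>q\<close> be points of the arc realizing the diameter, \<open>p\<close> first.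
    The arc runs from its initial point \<open>x\<close> through \<open>p\<close> and \<open>q\<close> to its end point \<open>y\<close>, so
    \<open>|x - p| + |p - q| + |q - y| \<le> H\<^sup>1 \<Gamma> \<le> |p - q| + S\<close> and therefore \<open>|x - p| + |q - y| \<le> S\<close>.
    The triangle inequality gives \<open>diam \<Gamma> \<le> |x - y| + S\<close>, and so \<open>H\<^sup>1 \<Gamma> \<le> |x - y| + 2 S\<close>
    (\<open>measure_le_chord_if_le_diameter\<close>).

  \<^item> \<^emph>\<open>From measure to length.\<close> The Hausdorff measure of a path is at least the distance between
    its end points, and the measure is additive on disjoint compact sets. Cutting an
    arc at finitely many points thus bounds every inscribed polygon by the Hausdorff measure
    (\<open>arc_length_le_hausdorff_measure1\<close>).
\<close>

section \<open>Hausdorff content\<close>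

lemma diameter_leI:
  fixes S :: "'a::metric_space set"
  assumes "0 \<le> d" "\<And>x y. x \<in> S \<Longrightarrow> y \<in> S \<Longrightarrow> dist x y \<le> d"
  shows "bounded S" "diameter S \<le> d"
proof -
  show "bounded S"
    unfolding bounded_any_center[of S] bounded_two_points using assms by blast
  show "diameter S \<le> d"
    unfolding diameter_def using assms by (auto intro!: cSUP_least)
qed

lemma hausdorff_content1_leI:
  assumes "E \<subseteq> (\<Union>i. C i)" "\<And>i::nat. bounded (C i)" "\<And>i. diameter (C i) \<le> \<delta>"
  shows "hausdorff_content1 \<delta> E \<le> (\<Sum>i. ennreal (diameter (C i)))"
  unfolding hausdorff_content1_def by (rule INF_lower) (use assms in auto)

lemma hausdorff_content1_approx:
  assumes "hausdorff_content1 \<delta> E < \<infinity>" "0 < \<eta>"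
  obtains C :: "nat \<Rightarrow> 'a::metric_space set"
  where "E \<subseteq> (\<Union>i. C i)" "\<And>i. bounded (C i)" "\<And>i. diameter (C i) \<le> \<delta>"
    "(\<Sum>i. ennreal (diameter (C i))) \<le> hausdorff_content1 \<delta> E + ennreal \<eta>"
proof -
  have "hausdorff_content1 \<delta> E < hausdorff_content1 \<delta> E + ennreal \<eta>"
    using assms by (simp add: ennreal_add_left_cancel_less)
  then obtain C :: "nat \<Rightarrow> 'a set" where "E \<subseteq> (\<Union>i. C i) \<and> (\<forall>i. bounded (C i) \<and> diameter (C i) \<le> \<delta>)"
    "(\<Sum>i. ennreal (diameter (C i))) < hausdorff_content1 \<delta> E + ennreal \<eta>"
    unfolding hausdorff_content1_def[of \<delta> E] INF_less_iff by auto
  then show ?thesis using that by auto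
qed

lemma hausdorff_content1_mono:
  assumes "E \<subseteq> F"
  shows "hausdorff_content1 \<delta> E \<le> hausdorff_content1 \<delta> F"
  unfolding hausdorff_content1_def by (rule INF_superset_mono) (use assms in auto)

lemma hausdorff_content1_antimono:
  assumes "\<delta> \<le> \<epsilon>"
  shows "hausdorff_content1 \<epsilon> E \<le> hausdorff_content1 \<delta> E"
  unfolding hausdorff_content1_def
  by (rule INF_superset_mono) (use assms in \<open>auto intro: order_trans\<close>)

lemma hausdorff_content1_le_diameter:
  assumes "bounded E" "diameter E \<le> \<delta>" "0 \<le> \<delta>"
  shows "hausdorff_content1 \<delta> E \<le> ennreal (diameter E)"
proof -
  have "hausdorff_content1 \<delta> E \<le> (\<Sum>i. ennreal (diameter (if i = (0::nat) then E else {})))"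
    by (rule hausdorff_content1_leI) (use assms in \<open>auto split: if_splits\<close>)
  also have "\<dots> = (\<Sum>i\<in>{0::nat}. ennreal (diameter (if i = (0::nat) then E else {})))"
    by (rule suminf_finite) auto
  finally show ?thesis by simp
qed

lemma hausdorff_content1_le:
  assumes "0 \<le> d" "d \<le> \<delta>" "\<And>x y. x \<in> E \<Longrightarrow> y \<in> E \<Longrightarrow> dist x y \<le> d"
  shows "hausdorff_content1 \<delta> E \<le> ennreal d"
proof -
  have "hausdorff_content1 \<delta> E \<le> ennreal (diameter E)"
    using diameter_leI[of d E, OF assms(1,3)] assms(1,2)
    by (intro hausdorff_content1_le_diameter) auto
  also have "\<dots> \<le> ennreal d"
    using diameter_leI[of d E, OF assms(1,3)] by (simp add: ennreal_leI)
  finally show ?thesis .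
qed

lemma hausdorff_content1_empty: "0 \<le> \<delta> \<Longrightarrow> hausdorff_content1 \<delta> {} = 0"
  using hausdorff_content1_le[of 0 \<delta> "{}"] by simp

text \<open>Nearly optimal covers of the \<open>E i\<close>, with errors \<open>\<eta> / 2 ^ Suc i\<close>, together form a cover of the
  union.\<close>
lemma hausdorff_content1_UN:
  fixes E :: "nat \<Rightarrow> 'a::metric_space set"
  shows "hausdorff_content1 \<delta> (\<Union>i. E i) \<le> (\<Sum>i. hausdorff_content1 \<delta> (E i))"
proof (cases "\<forall>i. hausdorff_content1 \<delta> (E i) < \<infinity>")
  case False
  then obtain i where "hausdorff_content1 \<delta> (E i) = \<infinity>" by (metis infinity_ennreal_def top.not_eq_extremum)
  then have "\<infinity> \<le> (\<Sum>i. hausdorff_content1 \<delta> (E i))"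
    using sum_le_suminf[OF summableI, of "{i}" "\<lambda>i. hausdorff_content1 \<delta> (E i)"] by simp
  then show ?thesis by (simp add: top_unique)
next
  case True
  show ?thesis
  proof (rule ennreal_le_epsilon)
    fix \<eta> :: real
    assume "0 < \<eta>"
    define e where "e i = \<eta> * (1/2) ^ Suc i" for i
    have e: "0 < e i" for i using \<open>0 < \<eta>\<close> by (simp add: e_def)
    have "\<exists>C :: nat \<Rightarrow> 'a set. E i \<subseteq> (\<Union>j. C j) \<and> (\<forall>j. bounded (C j) \<and> diameter (C j) \<le> \<delta>) \<and>
       (\<Sum>j. ennreal (diameter (C j))) \<le> hausdorff_content1 \<delta> (E i) + ennreal (e i)" for i
    proof -
      from True have "hausdorff_content1 \<delta> (E i) < \<infinity>" ..
      from hausdorff_content1_approx[OF this e[of i]] show ?thesis by metis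
    qed
    then obtain C :: "nat \<Rightarrow> nat \<Rightarrow> 'a set" where C:
      "\<And>i. E i \<subseteq> (\<Union>j. C i j)" "\<And>i j. bounded (C i j)" "\<And>i j. diameter (C i j) \<le> \<delta>"
      "\<And>i. (\<Sum>j. ennreal (diameter (C i j))) \<le> hausdorff_content1 \<delta> (E i) + ennreal (e i)"
      by metis
    have "hausdorff_content1 \<delta> (\<Union>i. E i)
        \<le> (\<Sum>k. ennreal (diameter (case prod_decode k of (i, j) \<Rightarrow> C i j)))"
    proof (rule hausdorff_content1_leI)
      show "(\<Union>i. E i) \<subseteq> (\<Union>k. case prod_decode k of (i, j) \<Rightarrow> C i j)"
      proof
        fix x
        assume "x \<in> (\<Union>i. E i)"
        then obtain i j where "x \<in> C i j" using C(1) by blast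
        then show "x \<in> (\<Union>k. case prod_decode k of (i, j) \<Rightarrow> C i j)"
          by (intro UN_I[of "prod_encode (i, j)"]) auto
      qed
    qed (auto simp: C split: prod.split)
    also have "\<dots> = (\<Sum>k. (\<lambda>(i, j). ennreal (diameter (C i j))) (prod_decode k))"
      by (simp add: case_prod_beta)
    also have "\<dots> = (\<Sum>i. \<Sum>j. ennreal (diameter (C i j)))"
      by (rule suminf_ennreal_2dimen) simp
    also have "\<dots> \<le> (\<Sum>i. hausdorff_content1 \<delta> (E i) + ennreal (e i))"
      by (intro suminf_le C(4)) auto
    also have "\<dots> = (\<Sum>i. hausdorff_content1 \<delta> (E i)) + (\<Sum>i. ennreal (e i))"
      by (rule suminf_add[symmetric]) auto
    also have "(\<Sum>i. ennreal (e i)) = ennreal \<eta>"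
    proof (rule suminf_ennreal_eq)
      show "e sums \<eta>"
        using sums_mult[OF power_half_series, of \<eta>] unfolding e_def by simp
    qed (use e less_imp_le in auto)
    finally show "hausdorff_content1 \<delta> (\<Union>i. E i) \<le> (\<Sum>i. hausdorff_content1 \<delta> (E i)) + ennreal \<eta>" .
  qed
qed

lemma hausdorff_content1_UN_finite:
  assumes "finite I" "0 \<le> \<delta>"
  shows "hausdorff_content1 \<delta> (\<Union>i\<in>I. E i) \<le> (\<Sum>i\<in>I. hausdorff_content1 \<delta> (E i))"
  using assms(1)
proof induction
  case empty
  then show ?case using assms(2) by (simp add: hausdorff_content1_empty)
next
  case (insert x F)
  define D where "D n = (if n = 0 then E x else if n = Suc 0 then (\<Union>i\<in>F. E i) else {})" for n
  have "(\<Union>i\<in>insert x F. E i) \<subseteq> (\<Union>n. D n)"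
    by (force simp: D_def)
  then have "hausdorff_content1 \<delta> (\<Union>i\<in>insert x F. E i) \<le> (\<Sum>n. hausdorff_content1 \<delta> (D n))"
    by (rule order_trans[OF hausdorff_content1_mono hausdorff_content1_UN])
  also have "\<dots> = (\<Sum>n\<in>{0, 1}. hausdorff_content1 \<delta> (D n))"
    by (rule suminf_finite) (auto simp: D_def hausdorff_content1_empty assms(2))
  also have "\<dots> = hausdorff_content1 \<delta> (E x) + hausdorff_content1 \<delta> (\<Union>i\<in>F. E i)"
    by (simp add: D_def)
  also have "\<dots> \<le> hausdorff_content1 \<delta> (E x) + (\<Sum>i\<in>F. hausdorff_content1 \<delta> (E i))"
    by (intro add_left_mono insert.IH)
  finally show ?case using insert by simp
qed

lemma hausdorff_content1_Un:
  assumes "0 \<le> \<delta>"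
  shows "hausdorff_content1 \<delta> (E \<union> F) \<le> hausdorff_content1 \<delta> E + hausdorff_content1 \<delta> F"
  using hausdorff_content1_UN_finite[of "UNIV :: bool set" \<delta> "\<lambda>b. if b then E else F"] assms
  by (simp add: UNIV_bool Un_commute add.commute)

section \<open>Hausdorff measure of an arc\<close>

text \<open>The distance to \<open>\<gamma> u\<close> is 1-Lipschitz, so it turns a cover of the path into a cover of the
  interval \<open>{0..dist (\<gamma> u) (\<gamma> v)}\<close> by intervals that are no longer than the diameters of the covering
  sets. Countable subadditivity of Lebesgue measure does the rest.\<close>
lemma continuous_image_content_ge_dist:
  fixes \<gamma> :: "real \<Rightarrow> 'a::metric_space"
  assumes "u \<le> v" "continuous_on {u..v} \<gamma>"
  shows "ennreal (dist (\<gamma> u) (\<gamma> v)) \<le> hausdorff_content1 \<delta> (\<gamma> ` {u..v})"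
  unfolding hausdorff_content1_def
proof (rule INF_greatest, clarify)
  fix C :: "nat \<Rightarrow> 'a set"
  assume cover: "\<gamma> ` {u..v} \<subseteq> (\<Union>i. C i)" and bd: "\<forall>i. bounded (C i) \<and> diameter (C i) \<le> \<delta>"
  define f where "f y = dist y (\<gamma> u)" for y
  define m where "m i = Inf (f ` C i)" for i
  have sub: "{0..dist (\<gamma> u) (\<gamma> v)} \<subseteq> (\<Union>i. {m i .. m i + diameter (C i)})"
  proof
    fix t
    assume t: "t \<in> {0..dist (\<gamma> u) (\<gamma> v)}"
    have "\<exists>s\<ge>u. s \<le> v \<and> f (\<gamma> s) = t"
      by (rule IVT') (use t assms in \<open>auto simp: f_def dist_commute intro!: continuous_intros\<close>)
    then obtain s where s: "s \<in> {u..v}" "f (\<gamma> s) = t" by auto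
    then obtain i where i: "\<gamma> s \<in> C i" using cover by blast
    have "m i \<le> t"
      unfolding m_def using i s(2) by (auto intro!: cInf_lower bdd_belowI[of _ 0] simp: f_def)
    moreover have "t - diameter (C i) \<le> m i"
      unfolding m_def
    proof (rule cInf_greatest)
      show "f ` C i \<noteq> {}" using i by blast
      fix z
      assume "z \<in> f ` C i"
      then obtain y where y: "y \<in> C i" "z = f y" by blast
      have "dist (\<gamma> s) y \<le> diameter (C i)"
        using bd i y by (intro diameter_bounded_bound) auto
      then show "t - diameter (C i) \<le> z"
        using dist_triangle[of "\<gamma> s" "\<gamma> u" y] s(2) y(2) by (simp add: f_def)
    qed
    ultimately show "t \<in> (\<Union>i. {m i .. m i + diameter (C i)})" by auto
  qed
  have "ennreal (dist (\<gamma> u) (\<gamma> v)) = emeasure lborel {0..dist (\<gamma> u) (\<gamma> v)}"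
    by simp
  also have "\<dots> \<le> emeasure lborel (\<Union>i. {m i .. m i + diameter (C i)})"
    by (intro emeasure_mono sub) auto
  also have "\<dots> \<le> (\<Sum>i. emeasure lborel {m i .. m i + diameter (C i)})"
    by (intro emeasure_subadditive_countably) auto
  also have "\<dots> = (\<Sum>i. ennreal (diameter (C i)))"
    using bd by (simp add: diameter_ge_0)
  finally show "ennreal (dist (\<gamma> u) (\<gamma> v)) \<le> (\<Sum>i. ennreal (diameter (C i)))" .
qed

lemma hausdorff_measure1_mono: "E \<subseteq> F \<Longrightarrow> hausdorff_measure1 E \<le> hausdorff_measure1 F"
  unfolding hausdorff_measure1_def by (intro SUP_mono) (blast intro: hausdorff_content1_mono)

text \<open>A covering set of diameter at most \<open>\<delta>\<close> cannot meet both \<open>E\<close> and \<open>F\<close>, so every cover of the union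
  splits into a cover of \<open>E\<close> and a cover of \<open>F\<close>.\<close>
lemma hausdorff_content1_separated:
  assumes "\<And>x y. x \<in> E \<Longrightarrow> y \<in> F \<Longrightarrow> \<delta> < dist x y"
  shows "hausdorff_content1 \<delta> E + hausdorff_content1 \<delta> F \<le> hausdorff_content1 \<delta> (E \<union> F)"
  unfolding hausdorff_content1_def[of \<delta> "E \<union> F"]
proof (rule INF_greatest, clarify)
  fix C :: "nat \<Rightarrow> 'a set"
  assume cover: "E \<union> F \<subseteq> (\<Union>i. C i)" and bd: "\<forall>i. bounded (C i) \<and> diameter (C i) \<le> \<delta>"
  define D where "D K i = (if C i \<inter> K = {} then {} else C i)" for K :: "'a set" and i
  have D: "bounded (D K i)" "diameter (D K i) \<le> \<delta>" for K i
    using bd diameter_ge_0[of "C i"] by (auto simp: D_def intro: order_trans)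
  have "hausdorff_content1 \<delta> E \<le> (\<Sum>i. ennreal (diameter (D E i)))"
    by (intro hausdorff_content1_leI D) (use cover in \<open>force simp: D_def\<close>)
  moreover have "hausdorff_content1 \<delta> F \<le> (\<Sum>i. ennreal (diameter (D F i)))"
    by (intro hausdorff_content1_leI D) (use cover in \<open>force simp: D_def\<close>)
  ultimately have "hausdorff_content1 \<delta> E + hausdorff_content1 \<delta> F
      \<le> (\<Sum>i. ennreal (diameter (D E i)) + ennreal (diameter (D F i)))"
    by (subst suminf_add[symmetric]) (auto intro: add_mono)
  also have "\<dots> \<le> (\<Sum>i. ennreal (diameter (C i)))"
  proof (rule suminf_le)
    fix i
    have "C i \<inter> E = {} \<or> C i \<inter> F = {}"
    proof (rule ccontr)
      assume "\<not> ?thesis"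
      then obtain x y where xy: "x \<in> C i" "x \<in> E" "y \<in> C i" "y \<in> F" by blast
      have "dist x y \<le> diameter (C i)"
        using bd xy by (intro diameter_bounded_bound) auto
      also have "\<dots> \<le> \<delta>" using bd by blast
      finally show False using assms[of x y] xy by simp
    qed
    then show "ennreal (diameter (D E i)) + ennreal (diameter (D F i)) \<le> ennreal (diameter (C i))"
      by (auto simp: D_def)
  qed auto
  finally show "hausdorff_content1 \<delta> E + hausdorff_content1 \<delta> F \<le> (\<Sum>i. ennreal (diameter (C i)))" .
qed

lemma hausdorff_measure1_disjoint_compact:
  assumes "compact E" "compact F" "E \<inter> F = {}"
  shows "hausdorff_measure1 E + hausdorff_measure1 F \<le> hausdorff_measure1 (E \<union> F)"
proof -
  obtain d where d: "0 < d" "\<And>x y. x \<in> E \<Longrightarrow> y \<in> F \<Longrightarrow> d \<le> dist x y"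
  proof (cases "E = {} \<or> F = {}")
    case False
    then obtain x where x: "x \<in> E" "\<And>y. y \<in> E \<Longrightarrow> infdist x F \<le> infdist y F"
      using continuous_attains_inf[OF assms(1), of "\<lambda>x. infdist x F"]
        continuous_on_infdist[OF continuous_on_id] by metis
    moreover have "0 < infdist x F"
      using False x(1) assms(3) compact_imp_closed[OF assms(2)]
      by (intro infdist_pos_not_in_closed) auto
    ultimately show ?thesis
      using that infdist_le order_trans by metis
  qed (use that[of 1] in auto)
  have key: "hausdorff_content1 \<delta> E + hausdorff_content1 \<epsilon> F \<le> hausdorff_measure1 (E \<union> F)"
    if "0 < \<delta>" "0 < \<epsilon>" for \<delta> \<epsilon>
  proof -
    define r where "r = min (d / 2) (min \<delta> \<epsilon>)"
    have r: "0 < r" "r < d" "r \<le> \<delta>" "r \<le> \<epsilon>" using that d(1) by (auto simp: r_def)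
    have "hausdorff_content1 \<delta> E + hausdorff_content1 \<epsilon> F
        \<le> hausdorff_content1 r E + hausdorff_content1 r F"
      by (intro add_mono hausdorff_content1_antimono r)
    also have "\<dots> \<le> hausdorff_content1 r (E \<union> F)"
      by (intro hausdorff_content1_separated) (use d(2) r(2) in force)
    also have "\<dots> \<le> hausdorff_measure1 (E \<union> F)"
      unfolding hausdorff_measure1_def by (rule SUP_upper) (use r in auto)
    finally show ?thesis .
  qed
  have ne: "{0::real<..} \<noteq> {}" by (auto intro: gt_ex)
  have "hausdorff_measure1 E + hausdorff_measure1 F
     = (SUP \<delta>\<in>{0<..}. SUP \<epsilon>\<in>{0<..}. hausdorff_content1 \<delta> E + hausdorff_content1 \<epsilon> F)"
    unfolding hausdorff_measure1_def
    by (simp add: ennreal_SUP_add_left[OF ne, symmetric] ennreal_SUP_add_right[OF ne, symmetric])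
  also have "\<dots> \<le> hausdorff_measure1 (E \<union> F)"
    by (intro SUP_least key) auto
  finally show ?thesis .
qed

text \<open>The subarcs over \<open>{a..u}\<close> and \<open>{u..v}\<close> share a point. Starting the second one at \<open>w > u\<close> makes
  them disjoint and compact, and \<open>w\<close> then tends to \<open>u\<close>.\<close>
lemma hausdorff_measure1_arc_extend:
  fixes \<gamma> :: "real \<Rightarrow> 'a::metric_space"
  assumes "continuous_on {a..b} \<gamma>" "inj_on \<gamma> {a..b}" "a \<le> u" "u \<le> v" "v \<le> b"
  shows "hausdorff_measure1 (\<gamma> ` {a..u}) + ennreal (dist (\<gamma> u) (\<gamma> v))
    \<le> hausdorff_measure1 (\<gamma> ` {a..v})"
proof (cases "u = v")
  case False
  then have uv: "u < v" using assms by simp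
  have cont: "continuous_on {c..d} \<gamma>" if "a \<le> c" "d \<le> b" for c d
    by (rule continuous_on_subset[OF assms(1)]) (use that in auto)
  have step: "hausdorff_measure1 (\<gamma> ` {a..u}) + ennreal (dist (\<gamma> w) (\<gamma> v))
      \<le> hausdorff_measure1 (\<gamma> ` {a..v})" if "u < w" "w \<le> v" for w
  proof -
    have "ennreal (dist (\<gamma> w) (\<gamma> v)) \<le> hausdorff_content1 1 (\<gamma> ` {w..v})"
      by (intro continuous_image_content_ge_dist cont) (use that assms in auto)
    also have "\<dots> \<le> hausdorff_measure1 (\<gamma> ` {w..v})"
      unfolding hausdorff_measure1_def by (rule SUP_upper) auto
    finally have "hausdorff_measure1 (\<gamma> ` {a..u}) + ennreal (dist (\<gamma> w) (\<gamma> v))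
        \<le> hausdorff_measure1 (\<gamma> ` {a..u}) + hausdorff_measure1 (\<gamma> ` {w..v})"
      by (rule add_left_mono)
    also have "\<dots> \<le> hausdorff_measure1 (\<gamma> ` {a..u} \<union> \<gamma> ` {w..v})"
    proof (intro hausdorff_measure1_disjoint_compact compact_continuous_image cont)
      have "\<gamma> ` {a..u} \<inter> \<gamma> ` {w..v} = \<gamma> ` ({a..u} \<inter> {w..v})"
        by (rule inj_on_image_Int[OF assms(2), symmetric]) (use that assms in auto)
      then show "\<gamma> ` {a..u} \<inter> \<gamma> ` {w..v} = {}" using that by auto
    qed (use that assms in auto)
    also have "\<dots> \<le> hausdorff_measure1 (\<gamma> ` {a..v})"
      by (rule hausdorff_measure1_mono) (use that assms in auto)
    finally show ?thesis .
  qed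
  have "continuous_on {u..v} \<gamma>" by (rule cont) (use assms in auto)
  then have "(\<gamma> \<longlongrightarrow> \<gamma> u) (at_right u)"
    using uv by (simp add: continuous_on_Icc_at_rightD)
  then have "((\<lambda>w. hausdorff_measure1 (\<gamma> ` {a..u}) + ennreal (dist (\<gamma> w) (\<gamma> v))) \<longlongrightarrow>
      hausdorff_measure1 (\<gamma> ` {a..u}) + ennreal (dist (\<gamma> u) (\<gamma> v))) (at_right u)"
    by (intro tendsto_intros tendsto_ennrealI)
  then show ?thesis
    by (rule tendsto_upperbound)
      (use uv in \<open>auto simp: eventually_at_right_field intro!: exI[of _ v] step\<close>)
qed simp

lemma arc_length_le_hausdorff_measure1:
  fixes \<gamma> :: "real \<Rightarrow> 'a::metric_space"
  assumes cont: "continuous_on {a..b} \<gamma>" and inj: "inj_on \<gamma> {a..b}"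
  shows "arc_length a b \<gamma> \<le> hausdorff_measure1 (\<gamma> ` {a..b})"
  unfolding arc_length_def
proof (rule SUP_least, clarify)
  fix n :: nat and t :: "nat \<Rightarrow> real"
  assume t: "strict_mono_on {..n} t" "t ` {..n} \<subseteq> {a..b}"
  have "(\<Sum>i = 1..k. ennreal (dist (\<gamma> (t (i - 1))) (\<gamma> (t i))))
      \<le> hausdorff_measure1 (\<gamma> ` {a..t k})" if "k \<le> n" for k
    using that
  proof (induction k)
    case (Suc k)
    have "t k \<le> t (Suc k)"
      using strict_mono_onD[OF t(1), of k "Suc k"] Suc.prems by simp
    moreover have "a \<le> t k" "t (Suc k) \<le> b" using t(2) Suc.prems by (auto simp: image_subset_iff)
    ultimately have "hausdorff_measure1 (\<gamma> ` {a..t k}) + ennreal (dist (\<gamma> (t k)) (\<gamma> (t (Suc k))))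
      \<le> hausdorff_measure1 (\<gamma> ` {a..t (Suc k)})"
      by (intro hausdorff_measure1_arc_extend[OF cont inj])
    moreover have "(\<Sum>i = 1..k. ennreal (dist (\<gamma> (t (i - 1))) (\<gamma> (t i))))
      \<le> hausdorff_measure1 (\<gamma> ` {a..t k})"
      using Suc by simp
    ultimately show ?case
      by (auto intro: order_trans add_right_mono)
  qed simp
  from this[of n] have "(\<Sum>i = 1..n. ennreal (dist (\<gamma> (t (i - 1))) (\<gamma> (t i))))
      \<le> hausdorff_measure1 (\<gamma> ` {a..t n})" by simp
  also have "\<dots> \<le> hausdorff_measure1 (\<gamma> ` {a..b})"
    by (rule hausdorff_measure1_mono) (use t(2) in auto)
  finally show "(\<Sum>i = 1..n. ennreal (dist (\<gamma> (t (i - 1))) (\<gamma> (t i))))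
      \<le> hausdorff_measure1 (\<gamma> ` {a..b})" .
qed

section \<open>Halving the mesh of a cover\<close>

text \<open>\<open>E\<close> behaves like a subset of a tube along which \<open>f\<close> is the coordinate: \<open>f\<close> spans a length of at
  most \<open>k h\<close> and the distance in the transversal directions is at most \<open>w\<close>. Cutting \<open>E\<close> at equally
  spaced values of \<open>f\<close> gives \<open>k\<close> slices of diameter at most \<open>sqrt (h\<^sup>2 + w\<^sup>2)\<close>.\<close>
lemma hausdorff_content1_slab:
  fixes f :: "'a::metric_space \<Rightarrow> real"
  assumes "0 < k"
    and width: "\<And>y z. y \<in> E \<Longrightarrow> z \<in> E \<Longrightarrow> \<bar>f y - f z\<bar> \<le> real k * h"
    and slab: "\<And>y z. y \<in> E \<Longrightarrow> z \<in> E \<Longrightarrow> (dist y z)\<^sup>2 \<le> (f y - f z)\<^sup>2 + w\<^sup>2"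
    and mesh: "sqrt (h\<^sup>2 + w\<^sup>2) \<le> \<delta>"
  shows "hausdorff_content1 \<delta> E \<le> ennreal (real k * sqrt (h\<^sup>2 + w\<^sup>2))"
proof (cases "E = {}")
  case True
  have "0 \<le> \<delta>" by (rule order_trans[OF _ mesh]) simp
  then show ?thesis using True by (simp add: hausdorff_content1_empty)
next
  case False
  then obtain e where e: "e \<in> E" by blast
  define m where "m = Inf (f ` E)"
  have bdd: "bdd_below (f ` E)"
    using width[OF e] by (intro bdd_belowI2[of _ "f e - real k * h"]) (force simp: abs_le_iff)
  have lo: "m \<le> f y" if "y \<in> E" for y
    unfolding m_def using that bdd by (simp add: cInf_lower)
  have hi: "f y \<le> m + real k * h" if "y \<in> E" for y
  proof -
    have "f y - real k * h \<le> m"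
      unfolding m_def using False width that by (intro cINF_greatest) (force simp: abs_le_iff)+
    then show ?thesis by simp
  qed
  define P where "P j = {y \<in> E. m + real j * h \<le> f y \<and> f y \<le> m + real (Suc j) * h}" for j
  have split: "\<exists>j<k. real j * h \<le> t \<and> t \<le> real (Suc j) * h" if "0 \<le> t" "t \<le> real k * h" for t
    using assms(1) that
  proof (induction k rule: nat_induct_non_zero)
    case (Suc k)
    show ?case
    proof (cases "t \<le> real k * h")
      case True
      then show ?thesis using Suc by (meson less_SucI)
    next
      case False
      then show ?thesis using Suc by (intro exI[of _ k]) auto
    qed
  qed auto
  have "E \<subseteq> (\<Union>j\<in>{..<k}. P j)"
  proof
    fix y
    assume y: "y \<in> E"
    obtain j where "j < k" "real j * h \<le> f y - m" "f y - m \<le> real (Suc j) * h"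
      using split[of "f y - m"] lo[OF y] hi[OF y] by auto
    then show "y \<in> (\<Union>j\<in>{..<k}. P j)"
      using y by (intro UN_I[of j]) (auto simp: P_def)
  qed
  moreover have "0 \<le> \<delta>" by (rule order_trans[OF _ mesh]) simp
  ultimately have "hausdorff_content1 \<delta> E \<le> (\<Sum>j<k. hausdorff_content1 \<delta> (P j))"
    by (intro order_trans[OF hausdorff_content1_mono hausdorff_content1_UN_finite]) auto
  also have "\<dots> \<le> (\<Sum>j<k. ennreal (sqrt (h\<^sup>2 + w\<^sup>2)))"
  proof (intro sum_mono hausdorff_content1_le mesh)
    fix j y z
    assume yz: "y \<in> P j" "z \<in> P j"
    have "\<bar>f y - f z\<bar> \<le> \<bar>h\<bar>"
      using yz by (auto simp: P_def algebra_simps)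
    then have "(f y - f z)\<^sup>2 \<le> h\<^sup>2" by (simp add: abs_le_square_iff)
    then have "(dist y z)\<^sup>2 \<le> h\<^sup>2 + w\<^sup>2"
      using slab[of y z] yz by (auto simp: P_def)
    then show "dist y z \<le> sqrt (h\<^sup>2 + w\<^sup>2)" by (rule real_le_rsqrt)
  qed simp
  also have "\<dots> = ennreal (real k * sqrt (h\<^sup>2 + w\<^sup>2))"
    by (simp add: ennreal_mult ennreal_of_nat_eq_real_of_nat)
  finally show ?thesis .
qed

text \<open>The number \<open>\<theta> x\<close> measures, relative to \<open>s\<close>, how far \<open>\<Gamma>\<close> is from a line near the net point \<open>x\<close>;
  points with \<open>\<theta> x > 1/2\<close> count as not flat. The function \<open>f\<close> stands for the orthogonal projection to
  the line.

  A cover of mesh \<open>4 s\<close> is refined as follows. The part of \<open>\<Gamma>\<close> within \<open>s\<close> of points that are not flat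
  is covered by balls. Every remaining piece of diameter greater than \<open>2 s\<close> is close to a flat point
  and is cut into three slices. Three slices are used because two of them could slightly exceed the
  diameter \<open>2 s\<close>.\<close>
lemma hausdorff_content1_halve:
  fixes \<Gamma> X :: "'a::metric_space set" and \<theta> :: "'a \<Rightarrow> real"
  assumes "finite X" "0 < s" and net: "\<Gamma> \<subseteq> (\<Union>x\<in>X. cball x s)"
    and \<theta>: "\<And>x. x \<in> X \<Longrightarrow> 0 \<le> \<theta> x"
    and flat: "\<And>x. x \<in> X \<Longrightarrow> \<theta> x \<le> 1/2 \<Longrightarrow> \<exists>f :: 'a \<Rightarrow> real.
      \<forall>y\<in>\<Gamma> \<inter> cball x (5 * s). \<forall>z\<in>\<Gamma> \<inter> cball x (5 * s).
        \<bar>f y - f z\<bar> \<le> dist y z \<and> (dist y z)\<^sup>2 \<le> (f y - f z)\<^sup>2 + (2 * \<theta> x * s)\<^sup>2"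
  shows "hausdorff_content1 (2 * s) \<Gamma> \<le>
    hausdorff_content1 (4 * s) \<Gamma> + ennreal (90 * (\<Sum>x\<in>X. (\<theta> x)\<^sup>2) * s)"
proof (cases "hausdorff_content1 (4 * s) \<Gamma> < \<infinity>")
  case True
  show ?thesis
  proof (rule ennreal_le_epsilon)
    fix e :: real
    assume "0 < e"
    define \<eta> where "\<eta> = min e s"
    have \<eta>: "0 < \<eta>" "\<eta> \<le> e" "\<eta> \<le> s" using \<open>0 < e\<close> \<open>0 < s\<close> by (auto simp: \<eta>_def)
    obtain C where C: "\<Gamma> \<subseteq> (\<Union>i. C i)" "\<And>i. bounded (C i)" "\<And>i. diameter (C i) \<le> 4 * s"
      and near_opt: "(\<Sum>i. ennreal (diameter (C i))) \<le> hausdorff_content1 (4 * s) \<Gamma> + ennreal \<eta>"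
      using hausdorff_content1_approx[OF True \<eta>(1)] by blast
    define d where "d i = diameter (C i)" for i
    have d: "0 \<le> d i" "d i \<le> 4 * s" for i
      using C by (auto simp: d_def diameter_ge_0)
    have dist_d: "dist y z \<le> d i" if "y \<in> C i" "z \<in> C i" for y z i
      unfolding d_def using that C(2) by (intro diameter_bounded_bound)
    have fin: "(\<Sum>i. ennreal (d i)) < \<infinity>"
      using near_opt True unfolding d_def by (intro le_less_trans[OF near_opt]) simp
    \<comment> \<open>\<open>N\<close> and \<open>F\<close> are the nonflat and the flat net points, \<open>P i\<close> is what remains of a covering set
      away from the nonflat points, and \<open>I\<close> lists the pieces that have to be cut.\<close>
    define N where "N = {x \<in> X. \<theta> x > 1/2}"
    define F where "F = X - N"
    have XNF: "X = N \<union> F" "N \<inter> F = {}" "finite N" "finite F"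
      using \<open>finite X\<close> by (auto simp: N_def F_def)
    define P where "P i = C i \<inter> \<Gamma> - (\<Union>x\<in>N. cball x s)" for i
    define I where "I = {i. d i > 2 * s \<and> P i \<noteq> {}}"
    have "\<forall>i\<in>I. \<exists>x. x \<in> F \<and> (\<exists>y\<in>P i. dist x y \<le> s)"
    proof
      fix i
      assume "i \<in> I"
      then obtain y where y: "y \<in> P i" by (auto simp: I_def)
      then obtain x where x: "x \<in> X" "dist x y \<le> s" using net by (auto simp: P_def)
      then have "x \<in> F" using y by (auto simp: P_def F_def)
      then show "\<exists>x. x \<in> F \<and> (\<exists>y\<in>P i. dist x y \<le> s)"
        using x(2) y by blast
    qed
    then obtain \<xi> where \<xi>: "\<And>i. i \<in> I \<Longrightarrow> \<xi> i \<in> F" "\<And>i. i \<in> I \<Longrightarrow> \<exists>y\<in>P i. dist (\<xi> i) y \<le> s"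
      by metis
    have C_ball: "C i \<subseteq> cball (\<xi> i) (5 * s)" if i: "i \<in> I" for i
    proof
      fix z
      assume z: "z \<in> C i"
      obtain y where "y \<in> C i" "dist (\<xi> i) y \<le> s" using \<xi>(2)[OF i] by (auto simp: P_def)
      then have "dist (\<xi> i) z \<le> s + 4 * s"
        using dist_triangle[of "\<xi> i" z y] dist_d[of y i z] z d(2)[of i] by linarith
      then show "z \<in> cball (\<xi> i) (5 * s)" by simp
    qed
    have F_flat: "\<theta> x \<le> 1/2" "0 \<le> \<theta> x" "(2 * \<theta> x * s)\<^sup>2 \<le> s\<^sup>2" if "x \<in> F" for x
    proof -
      show *: "\<theta> x \<le> 1/2" "0 \<le> \<theta> x" using that \<theta> by (auto simp: F_def N_def)
      have "2 * \<theta> x * s \<le> 1 * s" using * \<open>0 < s\<close> by (intro mult_right_mono) auto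
      then show "(2 * \<theta> x * s)\<^sup>2 \<le> s\<^sup>2" using * \<open>0 < s\<close> by (intro power_mono) auto
    qed
    \<comment> \<open>Replacing the pieces in \<open>K\<close> by five slices of the tube around \<open>x\<close>, each of diameter at most
      \<open>4 s\<close>, would give another cover of mesh \<open>4 s\<close>. Each piece in \<open>K\<close> costs more than \<open>2 s\<close>, so near
      optimality bounds their number.\<close>
    have few: "finite {i\<in>I. \<xi> i = x} \<and> card {i\<in>I. \<xi> i = x} \<le> 10" if x: "x \<in> F" for x
    proof (rule finite_if_finite_subsets_card_bdd)
      fix K
      assume K: "K \<subseteq> {i\<in>I. \<xi> i = x}" "finite K"
      obtain f :: "'a \<Rightarrow> real" where
        f: "\<And>y z. y \<in> \<Gamma> \<inter> cball x (5 * s) \<Longrightarrow> z \<in> \<Gamma> \<inter> cball x (5 * s) \<Longrightarrow>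
          \<bar>f y - f z\<bar> \<le> dist y z \<and> (dist y z)\<^sup>2 \<le> (f y - f z)\<^sup>2 + (2 * \<theta> x * s)\<^sup>2"
        using flat[of x] x F_flat(1)[OF x] XNF(1) by blast
      have mesh: "sqrt ((2 * s)\<^sup>2 + (2 * \<theta> x * s)\<^sup>2) \<le> 4 * s"
        using F_flat(3)[OF x] \<open>0 < s\<close> by (intro real_le_lsqrt) (auto simp: power2_eq_square)
      have "hausdorff_content1 (4 * s) (\<Gamma> \<inter> cball x (5 * s))
          \<le> ennreal (real 5 * sqrt ((2 * s)\<^sup>2 + (2 * \<theta> x * s)\<^sup>2))"
      proof (rule hausdorff_content1_slab[where f = f])
        fix y z
        assume yz: "y \<in> \<Gamma> \<inter> cball x (5 * s)" "z \<in> \<Gamma> \<inter> cball x (5 * s)"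
        show "\<bar>f y - f z\<bar> \<le> real 5 * (2 * s)"
          using f[OF yz] yz dist_triangle3[of y z x] by simp
        show "(dist y z)\<^sup>2 \<le> (f y - f z)\<^sup>2 + (2 * \<theta> x * s)\<^sup>2" using f[OF yz] by simp
      qed (use mesh in auto)
      also have "\<dots> \<le> ennreal (20 * s)" using mesh by (intro ennreal_leI) simp
      finally have tube: "hausdorff_content1 (4 * s) (\<Gamma> \<inter> cball x (5 * s)) \<le> ennreal (20 * s)" .
      define R where "R = (\<Sum>i. ennreal (if i \<in> K then 0 else d i))"
      have "\<Gamma> \<subseteq> (\<Union>i. if i \<in> K then {} else C i) \<union> (\<Gamma> \<inter> cball x (5 * s))"
      proof
        fix y
        assume y: "y \<in> \<Gamma>"
        then obtain i where i: "y \<in> C i" using C(1) by blast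
        show "y \<in> (\<Union>i. if i \<in> K then {} else C i) \<union> (\<Gamma> \<inter> cball x (5 * s))"
        proof (cases "i \<in> K")
          case True
          then have "C i \<subseteq> cball x (5 * s)" using K(1) C_ball[of i] by auto
          then show ?thesis using i y by blast
        next
          case False
          then show ?thesis using i by auto
        qed
      qed
      then have "hausdorff_content1 (4 * s) \<Gamma> \<le>
          hausdorff_content1 (4 * s) (\<Union>i. if i \<in> K then {} else C i) +
          hausdorff_content1 (4 * s) (\<Gamma> \<inter> cball x (5 * s))"
        using \<open>0 < s\<close> by (intro order_trans[OF hausdorff_content1_mono hausdorff_content1_Un]) auto
      also have "hausdorff_content1 (4 * s) (\<Union>i. if i \<in> K then {} else C i) \<le>
          (\<Sum>i. ennreal (diameter (if i \<in> K then {} else C i)))"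
        by (rule hausdorff_content1_leI) (use C \<open>0 < s\<close> in auto)
      also have "\<dots> = R"
        unfolding R_def d_def by (rule arg_cong[where f = suminf]) (auto simp: fun_eq_iff)
      finally have "hausdorff_content1 (4 * s) \<Gamma> \<le> R + ennreal (20 * s)"
        using tube by (auto intro: order_trans add_mono)
      then have "(\<Sum>i. ennreal (d i)) \<le> R + ennreal (20 * s) + ennreal \<eta>"
        using near_opt unfolding d_def by (auto intro: order_trans add_right_mono)
      moreover have "(\<Sum>i. ennreal (d i)) = R + (\<Sum>i\<in>K. ennreal (d i))"
      proof -
        have "(\<Sum>i. ennreal (d i)) = (\<Sum>i. ennreal (if i \<in> K then 0 else d i) + ennreal (if i \<in> K then d i else 0))"
          by (rule arg_cong[where f = suminf]) (auto simp: fun_eq_iff)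
        also have "\<dots> = R + (\<Sum>i. ennreal (if i \<in> K then d i else 0))"
          unfolding R_def by (rule suminf_add[symmetric]) auto
        also have "(\<Sum>i. ennreal (if i \<in> K then d i else 0)) = (\<Sum>i\<in>K. ennreal (if i \<in> K then d i else 0))"
          by (rule suminf_finite) (use K in auto)
        finally show ?thesis by simp
      qed
      ultimately have "R + (\<Sum>i\<in>K. ennreal (d i)) \<le> R + (ennreal (20 * s) + ennreal \<eta>)"
        by (simp add: add.assoc)
      moreover have "R < \<infinity>"
        using fin unfolding R_def
        by (rule le_less_trans[rotated]) (intro suminf_le, auto)
      ultimately have "(\<Sum>i\<in>K. ennreal (d i)) \<le> ennreal (20 * s) + ennreal \<eta>"
        by (auto simp: ennreal_add_left_cancel_le)
      then have "ennreal (\<Sum>i\<in>K. d i) \<le> ennreal (20 * s + \<eta>)"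
        using d \<eta> \<open>0 < s\<close> by (simp add: sum_ennreal)
      then have "(\<Sum>i\<in>K. d i) \<le> 20 * s + \<eta>"
        using \<eta> \<open>0 < s\<close> by (subst (asm) ennreal_le_iff) auto
      moreover have "real (card K) * (2 * s) \<le> (\<Sum>i\<in>K. d i)"
        using K by (intro sum_bounded_below) (auto simp: I_def)
      ultimately have "real (card K) * (2 * s) \<le> 21 * s" using \<eta> by linarith
      then have "(real (card K) * 2) * s \<le> 21 * s" by (simp add: ac_simps)
      then have "real (card K) * 2 \<le> 21" using \<open>0 < s\<close> by (rule mult_right_le_imp_le)
      then show "card K \<le> 10" by linarith
    qed
    have "I = (\<Union>x\<in>F. {i\<in>I. \<xi> i = x})" using \<xi>(1) by blast
    then have "finite I" using few XNF(4) by (metis (no_types, lifting) finite_UN_I)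
    define g where "g i = (if i \<in> I then 9 * (\<theta> (\<xi> i))\<^sup>2 * s else 0)" for i
    have g: "0 \<le> g i" for i using \<open>0 < s\<close> by (simp add: g_def)
    have piece: "hausdorff_content1 (2 * s) (P i) \<le> ennreal (d i) + ennreal (g i)" for i
    proof -
      have dist_P: "dist y z \<le> d i" if "y \<in> P i" "z \<in> P i" for y z
        using that dist_d by (auto simp: P_def)
      show ?thesis
      proof (cases "i \<in> I")
        case False
        have "hausdorff_content1 (2 * s) (P i) \<le> ennreal (d i)"
        proof (cases "P i = {}")
          case True
          then show ?thesis using \<open>0 < s\<close> by (simp add: hausdorff_content1_empty)
        next
          case nonempty: False
          then show ?thesis
            using False d dist_P by (intro hausdorff_content1_le) (auto simp: I_def)
        qed
        then show ?thesis using False by (simp add: g_def)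
      next
        case True
        \<comment> \<open>Slices of length \<open>d i / 3\<close> have total diameter \<open>sqrt (d\<^sup>2 + 36 t\<^sup>2 s\<^sup>2)\<close>, and \<open>d > 2 s\<close>
          makes the excess over \<open>d\<close> at most \<open>9 t\<^sup>2 s\<close>.\<close>
        define t where "t = \<theta> (\<xi> i)"
        have big: "2 * s < d i" using True by (simp add: I_def)
        have t: "0 \<le> t" "t \<le> 1/2" "(2 * t * s)\<^sup>2 \<le> s\<^sup>2" using F_flat[OF \<xi>(1)[OF True]] by (auto simp: t_def)
        obtain f :: "'a \<Rightarrow> real" where
          f: "\<And>y z. y \<in> \<Gamma> \<inter> cball (\<xi> i) (5 * s) \<Longrightarrow> z \<in> \<Gamma> \<inter> cball (\<xi> i) (5 * s) \<Longrightarrow>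
            \<bar>f y - f z\<bar> \<le> dist y z \<and> (dist y z)\<^sup>2 \<le> (f y - f z)\<^sup>2 + (2 * t * s)\<^sup>2"
          using flat[of "\<xi> i"] \<xi>(1)[OF True] t XNF(1) unfolding t_def by blast
        have P_ball: "P i \<subseteq> \<Gamma> \<inter> cball (\<xi> i) (5 * s)"
          using C_ball[OF True] by (auto simp: P_def)
        have "hausdorff_content1 (2 * s) (P i) \<le> ennreal (real 3 * sqrt ((d i / 3)\<^sup>2 + (2 * t * s)\<^sup>2))"
        proof (rule hausdorff_content1_slab[where f = f])
          fix y z
          assume yz: "y \<in> P i" "z \<in> P i"
          then have f': "\<bar>f y - f z\<bar> \<le> dist y z \<and> (dist y z)\<^sup>2 \<le> (f y - f z)\<^sup>2 + (2 * t * s)\<^sup>2"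
            using P_ball by (intro f) auto
          then show "\<bar>f y - f z\<bar> \<le> real 3 * (d i / 3)" using dist_P[OF yz] by simp
          show "(dist y z)\<^sup>2 \<le> (f y - f z)\<^sup>2 + (2 * t * s)\<^sup>2" using f' by simp
        next
          have "(d i / 3)\<^sup>2 \<le> (4 * s / 3)\<^sup>2" using d by (intro power_mono) auto
          also have "\<dots> = 16 / 9 * s\<^sup>2" by (simp add: power2_eq_square)
          finally have "(d i / 3)\<^sup>2 + (2 * t * s)\<^sup>2 \<le> 4 * s\<^sup>2"
            using t(3) zero_le_power2[of s] by linarith
          also have "\<dots> = (2 * s)\<^sup>2" by (simp add: power2_eq_square)
          finally show "sqrt ((d i / 3)\<^sup>2 + (2 * t * s)\<^sup>2) \<le> 2 * s"
            using \<open>0 < s\<close> by (intro real_le_lsqrt) auto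
        qed simp
        also have "real 3 * sqrt ((d i / 3)\<^sup>2 + (2 * t * s)\<^sup>2) = sqrt ((d i)\<^sup>2 + 36 * t\<^sup>2 * s\<^sup>2)"
        proof -
          have "real 3 * sqrt ((d i / 3)\<^sup>2 + (2 * t * s)\<^sup>2) = sqrt (3\<^sup>2 * ((d i / 3)\<^sup>2 + (2 * t * s)\<^sup>2))"
            by (subst real_sqrt_mult) simp
          also have "3\<^sup>2 * ((d i / 3)\<^sup>2 + (2 * t * s)\<^sup>2) = (d i)\<^sup>2 + 36 * t\<^sup>2 * s\<^sup>2"
            by (simp add: power2_eq_square algebra_simps)
          finally show ?thesis .
        qed
        also have "\<dots> \<le> d i + 9 * t\<^sup>2 * s"
        proof (rule real_le_lsqrt)
          have "36 * t\<^sup>2 * s\<^sup>2 = 2 * (2 * s) * (9 * t\<^sup>2 * s)" by (simp add: power2_eq_square)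
          also have "\<dots> \<le> 2 * d i * (9 * t\<^sup>2 * s)"
            using big \<open>0 < s\<close> by (intro mult_right_mono) auto
          also have "\<dots> \<le> 2 * d i * (9 * t\<^sup>2 * s) + (9 * t\<^sup>2 * s)\<^sup>2" by simp
          finally show "(d i)\<^sup>2 + 36 * t\<^sup>2 * s\<^sup>2 \<le> (d i + 9 * t\<^sup>2 * s)\<^sup>2"
            by (simp add: power2_sum)
        qed (use d \<open>0 < s\<close> in auto)
        also have "ennreal \<dots> = ennreal (d i) + ennreal (g i)"
          using True d \<open>0 < s\<close> by (simp add: g_def t_def)
        finally show ?thesis by (simp add: ennreal_leI)
      qed
    qed
    have cheap: "2 * s \<le> 90 * (\<theta> x)\<^sup>2 * s" if "x \<in> N" for x
    proof -
      have "(1/2)\<^sup>2 \<le> (\<theta> x)\<^sup>2" using that by (intro power_mono) (auto simp: N_def)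
      then show ?thesis using \<open>0 < s\<close> by (simp add: power2_eq_square)
    qed
    have "hausdorff_content1 (2 * s) (\<Union>x\<in>N. cball x s) \<le> (\<Sum>x\<in>N. hausdorff_content1 (2 * s) (cball x s))"
      using \<open>0 < s\<close> XNF(3) by (intro hausdorff_content1_UN_finite) auto
    also have "\<dots> \<le> (\<Sum>x\<in>N. ennreal (2 * s))"
    proof (intro sum_mono hausdorff_content1_le)
      fix x y z :: 'a
      assume "y \<in> cball x s" "z \<in> cball x s"
      then show "dist y z \<le> 2 * s" using dist_triangle3[of y z x] by simp
    qed (use \<open>0 < s\<close> in auto)
    also have "\<dots> \<le> (\<Sum>x\<in>N. ennreal (90 * (\<theta> x)\<^sup>2 * s))"
      by (intro sum_mono ennreal_leI cheap)
    also have "\<dots> = ennreal (\<Sum>x\<in>N. 90 * (\<theta> x)\<^sup>2 * s)"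
      using \<open>0 < s\<close> by (simp add: sum_ennreal)
    finally have nonflat_part: "hausdorff_content1 (2 * s) (\<Union>x\<in>N. cball x s)
        \<le> ennreal (\<Sum>x\<in>N. 90 * (\<theta> x)\<^sup>2 * s)" .
    have "(\<Sum>i\<in>I. g i) = (\<Sum>x\<in>F. \<Sum>i\<in>{i\<in>I. \<xi> i = x}. g i)"
      using \<open>finite I\<close> XNF(4) \<xi>(1) by (intro sum.group[symmetric]) auto
    also have "\<dots> \<le> (\<Sum>x\<in>F. 90 * (\<theta> x)\<^sup>2 * s)"
    proof (rule sum_mono)
      fix x
      assume x: "x \<in> F"
      have "(\<Sum>i\<in>{i\<in>I. \<xi> i = x}. g i) = real (card {i\<in>I. \<xi> i = x}) * (9 * (\<theta> x)\<^sup>2 * s)"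
        by (simp add: g_def)
      also have "\<dots> \<le> 10 * (9 * (\<theta> x)\<^sup>2 * s)"
        using few[OF x] \<open>0 < s\<close> by (intro mult_right_mono) auto
      finally show "(\<Sum>i\<in>{i\<in>I. \<xi> i = x}. g i) \<le> 90 * (\<theta> x)\<^sup>2 * s" by simp
    qed
    finally have sum_g: "(\<Sum>i\<in>I. g i) \<le> (\<Sum>x\<in>F. 90 * (\<theta> x)\<^sup>2 * s)" .
    have "hausdorff_content1 (2 * s) (\<Union>i. P i) \<le> (\<Sum>i. ennreal (d i) + ennreal (g i))"
      by (rule order_trans[OF hausdorff_content1_UN]) (intro suminf_le piece, auto)
    also have "\<dots> = (\<Sum>i. ennreal (d i)) + (\<Sum>i. ennreal (g i))"
      by (rule suminf_add[symmetric]) auto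
    also have "(\<Sum>i. ennreal (g i)) = (\<Sum>i\<in>I. ennreal (g i))"
      by (rule suminf_finite) (use \<open>finite I\<close> in \<open>auto simp: g_def\<close>)
    also have "\<dots> = ennreal (\<Sum>i\<in>I. g i)" using g by (simp add: sum_ennreal)
    also have "\<dots> \<le> ennreal (\<Sum>x\<in>F. 90 * (\<theta> x)\<^sup>2 * s)" by (rule ennreal_leI[OF sum_g])
    finally have flat_part: "hausdorff_content1 (2 * s) (\<Union>i. P i)
        \<le> (hausdorff_content1 (4 * s) \<Gamma> + ennreal \<eta>) + ennreal (\<Sum>x\<in>F. 90 * (\<theta> x)\<^sup>2 * s)"
      using near_opt unfolding d_def by (auto intro: order_trans add_right_mono)
    have "\<Gamma> \<subseteq> (\<Union>x\<in>N. cball x s) \<union> (\<Union>i. P i)"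
      using C(1) by (auto simp: P_def)
    then have "hausdorff_content1 (2 * s) \<Gamma> \<le>
        hausdorff_content1 (2 * s) (\<Union>x\<in>N. cball x s) + hausdorff_content1 (2 * s) (\<Union>i. P i)"
      using \<open>0 < s\<close> by (intro order_trans[OF hausdorff_content1_mono hausdorff_content1_Un]) auto
    also have "\<dots> \<le> ennreal (\<Sum>x\<in>N. 90 * (\<theta> x)\<^sup>2 * s) +
        ((hausdorff_content1 (4 * s) \<Gamma> + ennreal \<eta>) + ennreal (\<Sum>x\<in>F. 90 * (\<theta> x)\<^sup>2 * s))"
      by (rule add_mono[OF nonflat_part flat_part])
    also have "\<dots> = hausdorff_content1 (4 * s) \<Gamma> +
        (ennreal (\<Sum>x\<in>N. 90 * (\<theta> x)\<^sup>2 * s) + ennreal (\<Sum>x\<in>F. 90 * (\<theta> x)\<^sup>2 * s)) + ennreal \<eta>"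
      by (simp add: ac_simps)
    also have "ennreal (\<Sum>x\<in>N. 90 * (\<theta> x)\<^sup>2 * s) + ennreal (\<Sum>x\<in>F. 90 * (\<theta> x)\<^sup>2 * s)
        = ennreal (90 * (\<Sum>x\<in>X. (\<theta> x)\<^sup>2) * s)"
      unfolding XNF(1) using XNF \<open>0 < s\<close>
      by (simp add: sum.union_disjoint sum_nonneg sum_distrib_left sum_distrib_right distrib_left distrib_right
          flip: ennreal_plus)
    also have "ennreal \<eta> \<le> ennreal e" using \<eta> by (simp add: ennreal_leI)
    finally show "hausdorff_content1 (2 * s) \<Gamma> \<le>
        hausdorff_content1 (4 * s) \<Gamma> + ennreal (90 * (\<Sum>x\<in>X. (\<theta> x)\<^sup>2) * s) + ennreal e"
      by (auto intro: order_trans add_left_mono)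
  qed
next
  case False
  then have "hausdorff_content1 (4 * s) \<Gamma> = \<infinity>" by (metis infinity_ennreal_def top.not_eq_extremum)
  then show ?thesis by simp
qed

section \<open>Beta numbers control the loss\<close>

text \<open>\<open>f\<close> is the coordinate along a line that nearly attains the infimum in the beta number, and the
  orthogonal complement \<open>g y\<close> is no longer than the distance from \<open>y\<close> to that line.\<close>
lemma jones_beta_less_imp_slab:
  fixes \<Gamma> Q :: "'a::real_inner set"
  assumes "jones_beta \<Gamma> Q < ennreal t" "0 < diameter Q"
  shows "\<exists>f :: 'a \<Rightarrow> real. \<forall>y\<in>\<Gamma> \<inter> Q. \<forall>z\<in>\<Gamma> \<inter> Q.
    \<bar>f y - f z\<bar> \<le> dist y z \<and> (dist y z)\<^sup>2 \<le> (f y - f z)\<^sup>2 + (2 * (t * diameter Q))\<^sup>2"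
proof -
  obtain L where "L \<in> affine_lines"
    and L: "(SUP x\<in>Q \<inter> \<Gamma>. ennreal (infdist x L / diameter Q)) < ennreal t"
    using assms(1) unfolding jones_beta_def INF_less_iff by blast
  then obtain p v :: 'a where v: "v \<noteq> 0" "L = range (\<lambda>c::real. p + c *\<^sub>R v)"
    unfolding affine_lines_def by blast
  define u where "u = v /\<^sub>R norm v"
  have u: "inner u u = 1" "v = norm v *\<^sub>R u"
    using v(1) by (auto simp: u_def dot_square_norm power2_eq_square)
  have norm_add_u: "(norm (z + c *\<^sub>R u))\<^sup>2 = (norm z)\<^sup>2 + c\<^sup>2" if "inner z u = 0" for z c
    using that u(1) unfolding power2_norm_eq_inner
    by (simp add: inner_add_left inner_add_right inner_commute power2_eq_square)
  define f where "f y = inner (y - p) u" for y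
  define g where "g y = y - p - f y *\<^sub>R u" for y
  have gu: "inner (g y) u = 0" for y
    using u(1) by (simp add: g_def f_def inner_diff_left)
  have g_le: "norm (g y) \<le> infdist y L" for y
  proof -
    have "norm (g y) \<le> dist y (p + c *\<^sub>R v)" for c
    proof (rule power2_le_imp_le)
      have "y - (p + c *\<^sub>R v) = g y + (f y - c * norm v) *\<^sub>R u"
        by (subst u(2)) (simp add: g_def algebra_simps)
      then have "(dist y (p + c *\<^sub>R v))\<^sup>2 = (norm (g y))\<^sup>2 + (f y - c * norm v)\<^sup>2"
        by (simp only: dist_norm norm_add_u[OF gu])
      then show "(norm (g y))\<^sup>2 \<le> (dist y (p + c *\<^sub>R v))\<^sup>2" by simp
    qed simp
    then show ?thesis
      unfolding v(2) infdist_def by (auto intro!: cINF_greatest)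
  qed
  have near: "norm (g y) \<le> t * diameter Q" if "y \<in> \<Gamma> \<inter> Q" for y
  proof -
    have "ennreal (infdist y L / diameter Q) \<le> (SUP x\<in>Q \<inter> \<Gamma>. ennreal (infdist x L / diameter Q))"
      by (rule SUP_upper) (use that in auto)
    then have "ennreal (infdist y L / diameter Q) < ennreal t" using L by simp
    then have "infdist y L / diameter Q < t"
      using assms(2) by (simp add: ennreal_less_iff infdist_nonneg)
    then have "infdist y L < t * diameter Q" using assms(2) by (simp add: field_simps)
    then show ?thesis using g_le[of y] by simp
  qed
  have pyth: "(dist y z)\<^sup>2 = (f y - f z)\<^sup>2 + (norm (g y - g z))\<^sup>2" for y z
  proof -
    have "y - z = (g y - g z) + (f y - f z) *\<^sub>R u"
      by (simp add: g_def algebra_simps)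
    moreover have "inner (g y - g z) u = 0" using gu by (simp add: inner_diff_left)
    ultimately show ?thesis
      by (simp only: dist_norm norm_add_u add.commute)
  qed
  have "\<bar>f y - f z\<bar> \<le> dist y z" for y z
    using pyth[of y z] abs_le_square_iff[of "f y - f z" "dist y z"] by simp
  moreover have "(dist y z)\<^sup>2 \<le> (f y - f z)\<^sup>2 + (2 * (t * diameter Q))\<^sup>2"
    if "y \<in> \<Gamma> \<inter> Q" "z \<in> \<Gamma> \<inter> Q" for y z
  proof -
    have "norm (g y - g z) \<le> 2 * (t * diameter Q)"
      using near[OF that(1)] near[OF that(2)] norm_triangle_ineq4[of "g y" "g z"] by simp
    then have "(norm (g y - g z))\<^sup>2 \<le> (2 * (t * diameter Q))\<^sup>2"
      by (intro power_mono) auto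
    then show ?thesis using pyth[of y z] by simp
  qed
  ultimately show ?thesis by blast
qed

lemma diameter_cball_normed:
  fixes x e :: "'a::real_normed_vector"
  assumes "e \<noteq> 0" "0 \<le> r"
  shows "diameter (cball x r) = 2 * r"
proof (rule antisym)
  have "dist y z \<le> 2 * r" if "y \<in> cball x r" "z \<in> cball x r" for y z
    using dist_triangle3[of y z x] that by simp
  then show "diameter (cball x r) \<le> 2 * r"
    using assms(2) by (intro diameter_leI) auto
  define d where "d = (r / norm e) *\<^sub>R e"
  have d: "norm d = r" using assms by (simp add: d_def)
  have "(x + d) - (x - d) = 2 *\<^sub>R d" by (simp add: scaleR_2)
  then have "2 * r = dist (x + d) (x - d)" using d by (simp add: dist_norm)
  also have "\<dots> \<le> diameter (cball x r)"
    using d by (intro diameter_bounded_bound) (auto simp: dist_norm)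
  finally show "2 * r \<le> diameter (cball x r)" .
qed

text \<open>Needed because a multiresolution family is a set of balls: distinct pairs of a net point and a
  scale have to contribute distinct members to the sum. The vector \<open>e\<close> only witnesses that the space
  is not trivial.\<close>
lemma cball_eq_cball_iff_normed:
  fixes x y e :: "'a::real_normed_vector"
  assumes "e \<noteq> 0" "0 \<le> r" "0 \<le> s"
  shows "cball x r = cball y s \<longleftrightarrow> x = y \<and> r = s"
proof
  assume eq: "cball x r = cball y s"
  then have "2 * r = 2 * s"
    using diameter_cball_normed[OF assms(1)] assms(2,3) by metis
  then have rs: "r = s" by simp
  have "x = y"
  proof (rule ccontr)
    assume "x \<noteq> y"
    define z where "z = x + (r / norm (x - y)) *\<^sub>R (x - y)"
    have "z \<in> cball x r" using \<open>x \<noteq> y\<close> assms(2) by (simp add: z_def dist_norm)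
    then have "z \<in> cball y s" using eq by simp
    then have "dist y z \<le> r" using rs by simp
    moreover have "z - y = (1 + r / norm (x - y)) *\<^sub>R (x - y)"
      by (simp add: z_def algebra_simps)
    then have "dist y z = norm (x - y) + r"
      using \<open>x \<noteq> y\<close> assms(2) by (simp add: dist_norm norm_minus_commute[of y z] distrib_right)
    ultimately show False using \<open>x \<noteq> y\<close> by simp
  qed
  with rs show "x = y \<and> r = s" by simp
qed simp

text \<open>The infimum over lines need not be attained, so the flatness numbers are taken as
  \<open>2 A (\<beta> + \<eta>)\<close> with \<open>\<eta> > 0\<close>; the bound is continuous in \<open>\<eta>\<close>, which then tends to 0. The factor
  \<open>2 A\<close> converts from the diameter \<open>2 A s\<close> to the scale \<open>s\<close>.\<close>
lemma hausdorff_content1_halve_beta: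
  fixes \<Gamma> X :: "'a::real_inner set" and e :: 'a
  assumes "e \<noteq> 0" "finite X" "0 < s" "5 \<le> A" and net: "\<Gamma> \<subseteq> (\<Union>x\<in>X. cball x s)"
  shows "hausdorff_content1 (2 * s) \<Gamma> \<le> hausdorff_content1 (4 * s) \<Gamma> +
    ennreal (180 * A) * (\<Sum>x\<in>X. (jones_beta \<Gamma> (cball x (A * s)))\<^sup>2 * ennreal (diameter (cball x (A * s))))"
proof -
  define b where "b x = jones_beta \<Gamma> (cball x (A * s))" for x
  have diam: "diameter (cball x (A * s)) = 2 * A * s" for x :: 'a
    using diameter_cball_normed[OF assms(1), of "A * s" x] assms(3,4) by simp
  show ?thesis
  proof (cases "\<forall>x\<in>X. b x < \<infinity>")
    case False
    then obtain x where x: "x \<in> X" "b x = \<infinity>" by (metis infinity_ennreal_def top.not_eq_extremum)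
    have "(\<Sum>x\<in>X. (b x)\<^sup>2 * ennreal (2 * A * s)) = \<infinity>"
      using x assms(2,3,4)
      by (auto simp: power2_eq_square ennreal_mult_top ennreal_top_mult intro!: bexI[of _ x])
    then show ?thesis
      using assms(4) unfolding diam b_def by (simp add: ennreal_mult_top)
  next
    case True
    define r where "r x = enn2real (b x)" for x
    have b: "b x = ennreal (r x)" "0 \<le> r x" if "x \<in> X" for x
      using True that by (auto simp: r_def)
    have bound: "hausdorff_content1 (2 * s) \<Gamma> \<le> hausdorff_content1 (4 * s) \<Gamma> +
        ennreal (90 * (\<Sum>x\<in>X. (2 * A * (r x + \<eta>))\<^sup>2) * s)" if "0 < \<eta>" for \<eta>
    proof (rule hausdorff_content1_halve[OF assms(2,3) net])
      fix x
      assume x: "x \<in> X"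
      show "0 \<le> 2 * A * (r x + \<eta>)" using b[OF x] that assms(4) by simp
      have "b x < ennreal (r x + \<eta>)" using b[OF x] that by (simp add: ennreal_less_iff)
      moreover have Qpos: "0 < 2 * A * s" using assms(3,4) by simp
      ultimately obtain f :: "'a \<Rightarrow> real" where f: "\<And>y z. y \<in> \<Gamma> \<inter> cball x (A * s) \<Longrightarrow> z \<in> \<Gamma> \<inter> cball x (A * s) \<Longrightarrow>
          \<bar>f y - f z\<bar> \<le> dist y z \<and> (dist y z)\<^sup>2 \<le> (f y - f z)\<^sup>2 + (2 * ((r x + \<eta>) * (2 * A * s)))\<^sup>2"
        using jones_beta_less_imp_slab[of \<Gamma> "cball x (A * s)" "r x + \<eta>"] Qpos
        unfolding b_def diam by blast
      have "5 * s \<le> A * s" using assms(3,4) by simp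
      then have "cball x (5 * s) \<subseteq> cball x (A * s)" by (rule subset_cball)
      then have "\<bar>f y - f z\<bar> \<le> dist y z \<and> (dist y z)\<^sup>2 \<le> (f y - f z)\<^sup>2 + (2 * ((r x + \<eta>) * (2 * A * s)))\<^sup>2"
        if "y \<in> \<Gamma> \<inter> cball x (5 * s)" "z \<in> \<Gamma> \<inter> cball x (5 * s)" for y z
        using that by (intro f) blast+
      moreover have "2 * ((r x + \<eta>) * (2 * A * s)) = 2 * (2 * A * (r x + \<eta>)) * s" by simp
      ultimately show "\<exists>f :: 'a \<Rightarrow> real. \<forall>y\<in>\<Gamma> \<inter> cball x (5 * s). \<forall>z\<in>\<Gamma> \<inter> cball x (5 * s).
        \<bar>f y - f z\<bar> \<le> dist y z \<and> (dist y z)\<^sup>2 \<le> (f y - f z)\<^sup>2 + (2 * (2 * A * (r x + \<eta>)) * s)\<^sup>2"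
        by metis
    qed
    have "((\<lambda>\<eta>. hausdorff_content1 (4 * s) \<Gamma> + ennreal (90 * (\<Sum>x\<in>X. (2 * A * (r x + \<eta>))\<^sup>2) * s)) \<longlongrightarrow>
        hausdorff_content1 (4 * s) \<Gamma> + ennreal (90 * (\<Sum>x\<in>X. (2 * A * (r x + 0))\<^sup>2) * s)) (at_right 0)"
      by (intro tendsto_intros tendsto_ennrealI)
    then have "hausdorff_content1 (2 * s) \<Gamma> \<le>
        hausdorff_content1 (4 * s) \<Gamma> + ennreal (90 * (\<Sum>x\<in>X. (2 * A * (r x + 0))\<^sup>2) * s)"
      by (rule tendsto_lowerbound)
        (auto intro!: bound eventually_at_rightI[of 0 1])
    also have "90 * (\<Sum>x\<in>X. (2 * A * (r x + 0))\<^sup>2) * s = 180 * A * (\<Sum>x\<in>X. (r x)\<^sup>2 * (2 * A * s))"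
      by (simp add: sum_distrib_left sum_distrib_right power2_eq_square ac_simps)
    also have "ennreal \<dots> = ennreal (180 * A) * (\<Sum>x\<in>X. (b x)\<^sup>2 * ennreal (2 * A * s))"
      using assms(3,4) b
      by (subst ennreal_mult) (auto intro!: sum_nonneg sum.cong
          simp: ennreal_mult ennreal_power b simp flip: sum_ennreal)
    finally show ?thesis unfolding diam b_def .
  qed
qed

lemma finite_of_separated_in_compact:
  fixes E :: "'a::metric_space set"
  assumes "compact K" "E \<subseteq> K" "0 < \<epsilon>" "pairwise (\<lambda>x y. dist x y > \<epsilon>) E"
  shows "finite E"
proof -
  obtain k where k: "finite k" "K \<subseteq> (\<Union>x\<in>k. ball x (\<epsilon> / 2))"
    using seq_compact_imp_totally_bounded[OF compact_imp_seq_compact[OF assms(1)]] assms(3)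
    by (metis half_gt_zero)
  then have "\<forall>x\<in>E. \<exists>c\<in>k. dist c x < \<epsilon> / 2" using assms(2) by (force simp: subset_iff)
  then obtain c where c: "\<And>x. x \<in> E \<Longrightarrow> c x \<in> k" "\<And>x. x \<in> E \<Longrightarrow> dist (c x) x < \<epsilon> / 2" by metis
  have "inj_on c E"
  proof (rule inj_onI, rule ccontr)
    fix x y
    assume xy: "x \<in> E" "y \<in> E" "c x = c y" "x \<noteq> y"
    have "dist x y < \<epsilon>"
      using c(2)[OF xy(1)] c(2)[OF xy(2)] xy(3) dist_triangle3[of x y "c x"] by simp
    then show False using assms(4) xy by (force simp: pairwise_def)
  qed
  then show ?thesis
    using c(1) k(1) by (meson finite_imageD finite_subset image_subsetI)
qed

text \<open>Halving the mesh along the scales \<open>2 powi (- n)\<close> adds up the beta numbers of all balls of the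
  family. The normalization of \<open>n\<^sub>0\<close> allows covering \<open>\<Gamma>\<close> by itself at the coarsest scale, which is
  where the diameter, with constant 1, comes from.\<close>
lemma hausdorff_measure1_le_diameter_plus_beta:
  fixes \<Gamma> :: "'a::real_inner set" and e :: 'a
  assumes "e \<noteq> 0" "5 \<le> A" "compact \<Gamma>" and family: "multiresolution_family A n\<^sub>0 \<Gamma> \<H>"
    and diam: "diameter \<Gamma> \<le> 2 powi (- n\<^sub>0)"
  shows "hausdorff_measure1 \<Gamma> \<le> ennreal (diameter \<Gamma>) +
    ennreal (180 * A) * (\<Sum>\<^sub>\<infinity>Q\<in>\<H>. (jones_beta \<Gamma> Q)\<^sup>2 * ennreal (diameter Q))"
proof -
  obtain X where net: "\<And>n. n \<ge> n\<^sub>0 \<Longrightarrow> epsilon_net (2 powi (- n)) \<Gamma> (X n)"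
    and \<H>: "\<H> = {cball x (A * 2 powi (- n)) | x n. n \<ge> n\<^sub>0 \<and> x \<in> X n}"
    using family unfolding multiresolution_family_def by blast
  define s :: "nat \<Rightarrow> real" where "s k = 2 powi (- (n\<^sub>0 + int k))" for k :: nat
  define Y where "Y k = X (n\<^sub>0 + int k)" for k :: nat
  have s: "0 < s k" for k by (simp add: s_def)
  have s_Suc: "2 * s (Suc k) = s k" for k
  proof -
    have "s k = 2 powi (1 + - (n\<^sub>0 + int (Suc k)))" by (simp add: s_def algebra_simps)
    also have "\<dots> = 2 * s (Suc k)"
      unfolding s_def by (subst power_int_add) auto
    finally show ?thesis by simp
  qed
  have s_eq: "s k = s 0 * (1/2) ^ k" for k
  proof (induction k)
    case (Suc k)
    then show ?case using s_Suc[of k] by simp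
  qed simp
  have Y: "epsilon_net (s k) \<Gamma> (Y k)" for k
    using net[of "n\<^sub>0 + int k"] by (simp add: s_def Y_def)
  have fin: "finite (Y k)" for k
    using Y[of k] s[of k] assms(3) unfolding epsilon_net_def
    by (blast intro: finite_of_separated_in_compact)
  define w where "w Q = (jones_beta \<Gamma> Q)\<^sup>2 * ennreal (diameter Q)" for Q
  define B :: "nat \<times> 'a \<Rightarrow> 'a set" where "B = (\<lambda>(k, x). cball x (A * s k))"
  have level: "hausdorff_content1 (4 * s k) \<Gamma> \<le> ennreal (diameter \<Gamma>) +
      ennreal (180 * A) * (\<Sum>j<k. \<Sum>x\<in>Y j. w (cball x (A * s j)))" for k
  proof (induction k)
    case 0
    have "diameter \<Gamma> \<le> s 0" using diam by (simp add: s_def)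
    then have "diameter \<Gamma> \<le> 4 * s 0" using s[of 0] by linarith
    then show ?case
      using hausdorff_content1_le_diameter[of \<Gamma> "4 * s 0"] compact_imp_bounded[OF assms(3)] s[of 0] by simp
  next
    case (Suc k)
    have "4 * s (Suc k) = 2 * s k" using s_Suc[of k] by linarith
    then have "hausdorff_content1 (4 * s (Suc k)) \<Gamma> = hausdorff_content1 (2 * s k) \<Gamma>"
      by (rule arg_cong)
    also have "\<dots> \<le> hausdorff_content1 (4 * s k) \<Gamma> +
        ennreal (180 * A) * (\<Sum>x\<in>Y k. w (cball x (A * s k)))"
      unfolding w_def
      by (rule hausdorff_content1_halve_beta[OF assms(1) fin s assms(2)])
        (use Y[of k] in \<open>simp add: epsilon_net_def\<close>)
    also have "\<dots> \<le> (ennreal (diameter \<Gamma>) +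
      ennreal (180 * A) * (\<Sum>j<k. \<Sum>x\<in>Y j. w (cball x (A * s j)))) +
      ennreal (180 * A) * (\<Sum>x\<in>Y k. w (cball x (A * s k)))"
      by (rule add_right_mono[OF Suc.IH])
    finally show ?case by (simp add: distrib_left add.assoc)
  qed
  have total: "(\<Sum>j<k. \<Sum>x\<in>Y j. w (cball x (A * s j))) \<le> (\<Sum>\<^sub>\<infinity>Q\<in>\<H>. w Q)" for k
  proof -
    have inj: "inj_on B (SIGMA j:{..<k}. Y j)"
    proof (rule inj_onI, clarify)
      fix i x j y
      assume "B (i, x) = B (j, y)"
      then have "cball x (A * s i) = cball y (A * s j)" by (simp add: B_def)
      moreover have "0 \<le> A * s i" "0 \<le> A * s j" using assms(2) s[of i] s[of j] by simp_all
      ultimately have "x = y \<and> A * s i = A * s j"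
        using cball_eq_cball_iff_normed[OF assms(1)] by blast
      then have "x = y" "s i = s j" using assms(2) by auto
      then show "i = j \<and> x = y"
        using s[of 0] s_eq[of i] s_eq[of j] by (simp add: power_one_over)
    qed
    have sub: "B ` (SIGMA j:{..<k}. Y j) \<subseteq> \<H>"
    proof (clarify)
      fix j x
      assume "x \<in> Y j"
      then show "B (j, x) \<in> \<H>"
        unfolding \<H> B_def s_def Y_def by (auto intro!: exI[of _ "n\<^sub>0 + int j"])
    qed
    have "(\<Sum>j<k. \<Sum>x\<in>Y j. w (cball x (A * s j))) = (\<Sum>p\<in>(SIGMA j:{..<k}. Y j). w (B p))"
      by (subst sum.Sigma) (auto simp: fin B_def case_prod_beta)
    also have "\<dots> = (\<Sum>Q\<in>B ` (SIGMA j:{..<k}. Y j). w Q)"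
      by (simp add: sum.reindex[OF inj])
    also have "\<dots> \<le> (\<Sum>\<^sub>\<infinity>Q\<in>\<H>. w Q)"
      unfolding nonneg_infsum_complete[of \<H> w, OF zero_le]
      by (rule SUP_upper) (use sub fin in auto)
    finally show ?thesis .
  qed
  show ?thesis
    unfolding hausdorff_measure1_def
  proof (rule SUP_least)
    fix \<delta> :: real
    assume "\<delta> \<in> {0<..}"
    then have "0 < \<delta> / (4 * s 0)" using s[of 0] by simp
    then obtain k where "(1/2::real) ^ k < \<delta> / (4 * s 0)" using real_arch_pow_inv[of _ "1/2"] by auto
    then have "(1/2) ^ k * (4 * s 0) < \<delta>" using s[of 0] by (simp only: pos_less_divide_eq)
    then have "4 * s k \<le> \<delta>" using s_eq[of k] by (simp add: mult.left_commute mult.commute)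
    then have "hausdorff_content1 \<delta> \<Gamma> \<le> hausdorff_content1 (4 * s k) \<Gamma>"
      by (rule hausdorff_content1_antimono)
    also note level[of k]
    also have "(\<Sum>j<k. \<Sum>x\<in>Y j. w (cball x (A * s j))) \<le> (\<Sum>\<^sub>\<infinity>Q\<in>\<H>. w Q)" by (rule total)
    finally show "hausdorff_content1 \<delta> \<Gamma> \<le> ennreal (diameter \<Gamma>) +
        ennreal (180 * A) * (\<Sum>\<^sub>\<infinity>Q\<in>\<H>. (jones_beta \<Gamma> Q)\<^sup>2 * ennreal (diameter Q))"
      unfolding w_def by (simp add: add_left_mono mult_left_mono)
  qed
qed

section \<open>From the diameter to the chord\<close>

text \<open>If the measure of an arc barely exceeds the diameter, then the points realizing the diameter are
  close to the end points, because the arc also has to travel from its end points to them.\<close>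
lemma measure_le_chord_if_le_diameter:
  fixes \<gamma> :: "real \<Rightarrow> 'a::metric_space"
  assumes "a \<le> b" and cont: "continuous_on {a..b} \<gamma>" and inj: "inj_on \<gamma> {a..b}"
    and S: "hausdorff_measure1 (\<gamma> ` {a..b}) \<le> ennreal (diameter (\<gamma> ` {a..b})) + S"
  shows "hausdorff_measure1 (\<gamma> ` {a..b}) \<le> ennreal (dist (\<gamma> a) (\<gamma> b)) + 2 * S"
proof -
  have "compact (\<gamma> ` {a..b})" using cont by (intro compact_continuous_image) auto
  then obtain u v where uv: "u \<in> {a..b}" "v \<in> {a..b}" "u \<le> v"
    "dist (\<gamma> u) (\<gamma> v) = diameter (\<gamma> ` {a..b})"
  proof -
    obtain u v where "u \<in> {a..b}" "v \<in> {a..b}" "dist (\<gamma> u) (\<gamma> v) = diameter (\<gamma> ` {a..b})"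
      using diameter_compact_attained[OF \<open>compact (\<gamma> ` {a..b})\<close>] assms(1) by auto
    then show ?thesis using that[of u v] that[of v u] by (cases "u \<le> v") (auto simp: dist_commute)
  qed
  define D where "D = diameter (\<gamma> ` {a..b})"
  define p where "p = dist (\<gamma> a) (\<gamma> u)"
  define q where "q = dist (\<gamma> v) (\<gamma> b)"
  have D: "0 \<le> D" using uv(4) by (simp add: D_def flip: uv(4))
  have "ennreal p \<le> hausdorff_measure1 (\<gamma> ` {a..u})"
    using hausdorff_measure1_arc_extend[OF cont inj, of a u] uv(1)
    by (auto simp: p_def intro: order_trans[rotated])
  then have "ennreal p + ennreal D \<le> hausdorff_measure1 (\<gamma> ` {a..v})"
    using hausdorff_measure1_arc_extend[OF cont inj, of u v] uv
    by (auto simp: D_def intro: order_trans add_right_mono)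
  then have "ennreal p + ennreal D + ennreal q \<le> hausdorff_measure1 (\<gamma> ` {a..b})"
    using hausdorff_measure1_arc_extend[OF cont inj, of v b] uv
    by (auto simp: q_def intro: order_trans add_right_mono)
  then have "ennreal D + (ennreal p + ennreal q) \<le> hausdorff_measure1 (\<gamma> ` {a..b})"
    by (simp add: ac_simps)
  also have "\<dots> \<le> ennreal D + S" using S by (simp add: D_def)
  finally have "ennreal D + (ennreal p + ennreal q) \<le> ennreal D + S" .
  then have pq: "ennreal p + ennreal q \<le> S" by (auto simp: ennreal_add_left_cancel_le)
  have "D \<le> dist (\<gamma> a) (\<gamma> b) + (p + q)"
    using dist_triangle[of "\<gamma> u" "\<gamma> v" "\<gamma> a"] dist_triangle[of "\<gamma> a" "\<gamma> v" "\<gamma> b"] uv(4)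
    by (simp add: D_def p_def q_def dist_commute)
  then have "ennreal D \<le> ennreal (dist (\<gamma> a) (\<gamma> b) + (p + q))" by (rule ennreal_leI)
  also have "\<dots> = ennreal (dist (\<gamma> a) (\<gamma> b)) + (ennreal p + ennreal q)"
    by (simp add: p_def q_def)
  also have "\<dots> \<le> ennreal (dist (\<gamma> a) (\<gamma> b)) + S" by (rule add_left_mono[OF pq])
  finally have "ennreal D + S \<le> ennreal (dist (\<gamma> a) (\<gamma> b)) + S + S" by (rule add_right_mono)
  with S have "hausdorff_measure1 (\<gamma> ` {a..b}) \<le> ennreal (dist (\<gamma> a) (\<gamma> b)) + S + S"
    unfolding D_def by (rule order_trans)
  then show ?thesis by (simp add: mult_2 add.assoc)
qed

lemma ell2_nontrivial: "\<exists>e :: ell2. e \<noteq> 0"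
proof -
  have "summable (\<lambda>i::nat. (if i = 0 then 1 else 0 :: real)\<^sup>2)"
    by (rule summable_finite[of "{0}"]) auto
  then have "coord (Abs_ell2 (\<lambda>i. if i = 0 then 1 else 0)) 0 = 1"
    by (subst Abs_ell2_inverse) auto
  then show ?thesis by (metis coord_zero zero_neq_one)
qed

theorem theorem2:
  fixes A :: real
  assumes "A > 30"
  shows "\<exists>c::real. c > 0 \<and>
    (\<forall>(\<Gamma> :: ell2 set) a b \<gamma> n\<^sub>0 \<H>.
       jordan_arc_param \<Gamma> a b \<gamma> \<longrightarrow>
       multiresolution_family A n\<^sub>0 \<Gamma> \<H> \<longrightarrow>
       diameter \<Gamma> \<le> 2 powi (- n\<^sub>0) \<longrightarrow>
       (\<Sum>\<^sub>\<infinity>Q\<in>\<H>. (jones_beta \<Gamma> Q)\<^sup>2 * ennreal (diameter Q))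
         \<ge> ennreal c * (arc_length a b \<gamma> - ennreal (chord_length a b \<gamma>)))"
proof (intro exI[of _ "1 / (360 * A)"] conjI allI impI)
  show "0 < 1 / (360 * A)" using assms by simp
  fix \<Gamma> :: "ell2 set" and a b \<gamma> n\<^sub>0 \<H>
  assume arc: "jordan_arc_param \<Gamma> a b \<gamma>" and family: "multiresolution_family A n\<^sub>0 \<Gamma> \<H>"
    and diam: "diameter \<Gamma> \<le> 2 powi (- n\<^sub>0)"
  define T where "T = (\<Sum>\<^sub>\<infinity>Q\<in>\<H>. (jones_beta \<Gamma> Q)\<^sup>2 * ennreal (diameter Q))"
  from arc have ab: "a \<le> b" and cont: "continuous_on {a..b} \<gamma>" and inj: "inj_on \<gamma> {a..b}"
    and \<Gamma>: "\<Gamma> = \<gamma> ` {a..b}"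
    by (auto simp: jordan_arc_param_def bij_betw_def)
  have "compact \<Gamma>" unfolding \<Gamma> using cont by (intro compact_continuous_image) auto
  obtain e :: ell2 where "e \<noteq> 0" using ell2_nontrivial by blast
  then have "hausdorff_measure1 \<Gamma> \<le> ennreal (diameter \<Gamma>) + ennreal (180 * A) * T"
    unfolding T_def using assms \<open>compact \<Gamma>\<close> family diam
    by (intro hausdorff_measure1_le_diameter_plus_beta) auto
  then have "hausdorff_measure1 \<Gamma> \<le> ennreal (chord_length a b \<gamma>) + 2 * (ennreal (180 * A) * T)"
    unfolding \<Gamma> chord_length_def by (rule measure_le_chord_if_le_diameter[OF ab cont inj])
  then have "arc_length a b \<gamma> \<le> ennreal (chord_length a b \<gamma>) + 2 * (ennreal (180 * A) * T)"
    using arc_length_le_hausdorff_measure1[OF cont inj] unfolding \<Gamma> by (rule order_trans[rotated])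
  then have "arc_length a b \<gamma> - ennreal (chord_length a b \<gamma>) \<le> 2 * (ennreal (180 * A) * T)"
    by (simp add: ennreal_minus_le_iff)
  also have "\<dots> = ennreal (360 * A) * T"
  proof -
    have "2 * ennreal (180 * A) = ennreal (360 * A)"
      using assms by (simp flip: ennreal_numeral ennreal_mult)
    then show ?thesis by (simp flip: mult.assoc)
  qed
  finally have "ennreal (1 / (360 * A)) * (arc_length a b \<gamma> - ennreal (chord_length a b \<gamma>)) \<le>
      ennreal (1 / (360 * A)) * (ennreal (360 * A) * T)"
    by (rule mult_left_mono) simp
  also have "\<dots> = T"
    using assms by (simp add: mult.assoc[symmetric] flip: ennreal_mult)
  finally show "ennreal (1 / (360 * A)) * (arc_length a b \<gamma> - ennreal (chord_length a b \<gamma>)) \<le>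
      (\<Sum>\<^sub>\<infinity>Q\<in>\<H>. (jones_beta \<Gamma> Q)\<^sup>2 * ennreal (diameter Q))"
    unfolding T_def .
qed

end
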